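(* Let $X$ be an arbitrary set. Then there is an isomorphism of (continuous) Kegelspitzen $r_X:\mathbf{Q}(\mathbb C,\ell^\infty(X))\to\mathcal M(X,\sqsubseteq)$, where $\sqsubseteq$ is the discrete order on $X$. Furthermore, $r_X$ restricts to a bijection between the normal unital $*$-homomorphisms $\ell^\infty(X)\to\mathbb C$ (i.e. the morphisms of $\mathbf{Q}(\mathbb C,\ell^\infty(X))$ that are $*$-homomorphisms) and the Dirac valuations $\delta_x$, $x\in X$, in $\mathcal M(X,\sqsubseteq)$.
   Context: $\ell^\infty(X)$ is the von Neumann algebra of bounded functions $X\to\mathbb C$ acting by multiplication on $\ell^2(X)$. $\mathbf{Q}(\mathbb C,\ell^\infty(X))$ denotes the set of normal, completely positive, subunital linear maps $\ell^\infty(X)\to\mathbb C$ (the category $\mathbf Q$ is the opposite of the category of hereditarily atomic von Neumann algebras with such maps), ordered by $\varphi\le\psi$ iff $\psi-\varphi$ is completely positive, with convex structure $\varphi+_r\psi=r\varphi+(1-r)\psi$ and distinguished element the zero map. For a dcpo $D$ with Scott topology $\sigma D$, a subprobability valuation is a Scott-continuous map $\nu:\sigma D\to[0,1]$ with $\nu(\emptyset)=0$ and $\nu(U)+\nu(V)=\nu(U\cup V)+\nu(U\cap V)$; these form a dcpo $\mathcal V D$ under the pointwise (stochastic) order. Dirac valuations are $\delta_x(U)=1$ if $x\in U$ and $0$ otherwise; simple valuations are finite sums $\sum r_i\delta_{x_i}$ with $r_i\ge0$, $\sum r_i\le1$. $\mathcal M D$ is the smallest sub-dcpo of $\mathcal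 V D$ containing all simple valuations; it is given convex structure $\nu_1+_r\nu_2=r\nu_1+(1-r)\nu_2$ and least element the zero valuation. A Kegelspitze is a dcpo $K$ with a distinguished element $\bot$ and operations $+_r$ ($r\in[0,1]$) satisfying $a+_1b=a$, $a+_rb=b+_{1-r}a$, $a+_ra=a$, $(a+_pb)+_rc=a+_{pr}(b+_{\frac{r-pr}{1-pr}}c)$ for $r,p<1$, such that $(a,b)\mapsto a+_rb$ and $(r,a)\mapsto a+_r\bot$ are Scott-continuous; it is continuous if it is a continuous dcpo. An isomorphism of Kegelspitzen is an order isomorphism preserving $\bot$ and all $+_r$. *)

theory Defs
  imports "HOL-Analysis.Analysis" "HOL-Library.Function_Algebras"
begin

(* Conventions.  Posets, algebras and Kegelspitzen are given by explicit carrier sets, so that X may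
   be an arbitrary set, including the empty one.  A function that mathematically lives on a carrier
   set (an element of l^infty(X), a map of algebras, a valuation on the open sets) is represented by
   the total HOL function that vanishes outside that carrier; the pointwise operations preserve this. *)

subsection \<open>Dcpos, Scott continuity, continuous dcpos\<close>

definition directed_in :: "'a set \<Rightarrow> ('a \<Rightarrow> 'a \<Rightarrow> bool) \<Rightarrow> 'a set \<Rightarrow> bool" where
  "directed_in D le S \<longleftrightarrow>
     S \<subseteq> D \<and> S \<noteq> {} \<and> (\<forall>a\<in>S. \<forall>b\<in>S. \<exists>c\<in>S. le a c \<and> le b c)"

definition is_lub_in :: "'a set \<Rightarrow> ('a \<Rightarrow> 'a \<Rightarrow> bool) \<Rightarrow> 'a set \<Rightarrow> 'a \<Rightarrow> bool" where
  "is_lub_in D le S s \<longleftrightarrow>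
     s \<in> D \<and> (\<forall>a\<in>S. le a s) \<and> (\<forall>u\<in>D. (\<forall>a\<in>S. le a u) \<longrightarrow> le s u)"

definition dcpo_on :: "'a set \<Rightarrow> ('a \<Rightarrow> 'a \<Rightarrow> bool) \<Rightarrow> bool" where
  "dcpo_on D le \<longleftrightarrow>
     reflp_on D le \<and> antisymp_on D le \<and> transp_on D le \<and>
     (\<forall>S. directed_in D le S \<longrightarrow> (\<exists>s. is_lub_in D le S s))"

(* Monotonicity is implied: apply the condition to the directed set {a, b} with a below b. *)
definition scott_continuous_on ::
  "'a set \<Rightarrow> ('a \<Rightarrow> 'a \<Rightarrow> bool) \<Rightarrow> 'b set \<Rightarrow> ('b \<Rightarrow> 'b \<Rightarrow> bool) \<Rightarrow> ('a \<Rightarrow> 'b) \<Rightarrow> bool" where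
  "scott_continuous_on D leD E leE f \<longleftrightarrow>
     f \<in> D \<rightarrow> E \<and>
     (\<forall>S s. directed_in D leD S \<and> is_lub_in D leD S s \<longrightarrow> is_lub_in E leE (f ` S) (f s))"

definition scott_opens :: "'a set \<Rightarrow> ('a \<Rightarrow> 'a \<Rightarrow> bool) \<Rightarrow> 'a set set" where
  "scott_opens D le = {U. U \<subseteq> D \<and> (\<forall>a\<in>U. \<forall>b\<in>D. le a b \<longrightarrow> b \<in> U) \<and>
     (\<forall>S s. directed_in D le S \<and> is_lub_in D le S s \<and> s \<in> U \<longrightarrow> S \<inter> U \<noteq> {})}"

definition way_below :: "'a set \<Rightarrow> ('a \<Rightarrow> 'a \<Rightarrow> bool) \<Rightarrow> 'a \<Rightarrow> 'a \<Rightarrow> bool" where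
  "way_below D le x y \<longleftrightarrow>
     (\<forall>S s. directed_in D le S \<and> is_lub_in D le S s \<and> le y s \<longrightarrow> (\<exists>d\<in>S. le x d))"

definition continuous_dcpo_on :: "'a set \<Rightarrow> ('a \<Rightarrow> 'a \<Rightarrow> bool) \<Rightarrow> bool" where
  "continuous_dcpo_on D le \<longleftrightarrow> dcpo_on D le \<and>
     (\<forall>x\<in>D. directed_in D le {y\<in>D. way_below D le y x} \<and>
             is_lub_in D le {y\<in>D. way_below D le y x} x)"

definition prod_le ::
  "('a \<Rightarrow> 'a \<Rightarrow> bool) \<Rightarrow> ('b \<Rightarrow> 'b \<Rightarrow> bool) \<Rightarrow> 'a \<times> 'b \<Rightarrow> 'a \<times> 'b \<Rightarrow> bool" where
  "prod_le le1 le2 p q \<longleftrightarrow> le1 (fst p) (fst q) \<and> le2 (snd p) (snd q)"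

subsection \<open>Kegelspitzen\<close>

(* kcomb K r a b is a +_r b; only r in [0,1] is relevant. *)
record 'k kegel =
  kset :: "'k set"
  kle :: "'k \<Rightarrow> 'k \<Rightarrow> bool"
  kbot :: 'k
  kcomb :: "real \<Rightarrow> 'k \<Rightarrow> 'k \<Rightarrow> 'k"

definition kegelspitze :: "'k kegel \<Rightarrow> bool" where
  "kegelspitze K \<longleftrightarrow>
     dcpo_on (kset K) (kle K) \<and> kbot K \<in> kset K \<and>
     (\<forall>a\<in>kset K. \<forall>b\<in>kset K. kcomb K 1 a b = a) \<and>
     (\<forall>r\<in>{0..1}. \<forall>a\<in>kset K. \<forall>b\<in>kset K. kcomb K r a b = kcomb K (1 - r) b a) \<and>
     (\<forall>r\<in>{0..1}. \<forall>a\<in>kset K. kcomb K r a a = a) \<and>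
     (\<forall>p\<in>{0..<1}. \<forall>r\<in>{0..<1}. \<forall>a\<in>kset K. \<forall>b\<in>kset K. \<forall>c\<in>kset K.
        kcomb K r (kcomb K p a b) c =
        kcomb K (p * r) a (kcomb K ((r - p * r) / (1 - p * r)) b c)) \<and>
     (\<forall>r\<in>{0..1}. scott_continuous_on (kset K \<times> kset K) (prod_le (kle K) (kle K))
        (kset K) (kle K) (\<lambda>(a, b). kcomb K r a b)) \<and>
     scott_continuous_on ({0..1} \<times> kset K) (prod_le (\<le>) (kle K))
        (kset K) (kle K) (\<lambda>(r, a). kcomb K r a (kbot K))"

definition continuous_kegelspitze :: "'k kegel \<Rightarrow> bool" where
  "continuous_kegelspitze K \<longleftrightarrow> kegelspitze K \<and> continuous_dcpo_on (kset K) (kle K)"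

definition kegelspitze_iso :: "'k kegel \<Rightarrow> 'l kegel \<Rightarrow> ('k \<Rightarrow> 'l) \<Rightarrow> bool" where
  "kegelspitze_iso K L h \<longleftrightarrow>
     bij_betw h (kset K) (kset L) \<and>
     (\<forall>a\<in>kset K. \<forall>b\<in>kset K. kle K a b \<longleftrightarrow> kle L (h a) (h b)) \<and>
     h (kbot K) = kbot L \<and>
     (\<forall>r\<in>{0..1}. \<forall>a\<in>kset K. \<forall>b\<in>kset K. h (kcomb K r a b) = kcomb L r (h a) (h b))"

subsection \<open>Valuations\<close>

definition valuations :: "'a set \<Rightarrow> ('a \<Rightarrow> 'a \<Rightarrow> bool) \<Rightarrow> ('a set \<Rightarrow> real) set" where
  "valuations D le = {\<nu>.
     (\<forall>U. U \<notin> scott_opens D le \<longrightarrow> \<nu> U = 0) \<and>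
     scott_continuous_on (scott_opens D le) (\<subseteq>) {0..1} (\<le>) \<nu> \<and>
     \<nu> {} = 0 \<and>
     (\<forall>U\<in>scott_opens D le. \<forall>V\<in>scott_opens D le. \<nu> U + \<nu> V = \<nu> (U \<union> V) + \<nu> (U \<inter> V))}"

definition stochastic_le ::
  "'a set \<Rightarrow> ('a \<Rightarrow> 'a \<Rightarrow> bool) \<Rightarrow> ('a set \<Rightarrow> real) \<Rightarrow> ('a set \<Rightarrow> real) \<Rightarrow> bool" where
  "stochastic_le D le \<mu> \<nu> \<longleftrightarrow> (\<forall>U\<in>scott_opens D le. \<mu> U \<le> \<nu> U)"

definition dirac :: "'a set \<Rightarrow> ('a \<Rightarrow> 'a \<Rightarrow> bool) \<Rightarrow> 'a \<Rightarrow> 'a set \<Rightarrow> real" where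
  "dirac D le x U = (if U \<in> scott_opens D le \<and> x \<in> U then 1 else 0)"

definition simple_valuations :: "'a set \<Rightarrow> ('a \<Rightarrow> 'a \<Rightarrow> bool) \<Rightarrow> ('a set \<Rightarrow> real) set" where
  "simple_valuations D le = {\<nu>. \<exists>(n::nat) r x.
     (\<forall>i<n. x i \<in> D \<and> 0 \<le> r i) \<and> (\<Sum>i<n. r i) \<le> 1 \<and>
     \<nu> = (\<lambda>U. \<Sum>i<n. r i * dirac D le (x i) U)}"

(* A sub-dcpo is a subset closed under directed suprema taken in the ambient dcpo. *)
definition minimal_valuations :: "'a set \<Rightarrow> ('a \<Rightarrow> 'a \<Rightarrow> bool) \<Rightarrow> ('a set \<Rightarrow> real) set" where
  "minimal_valuations D le = \<Inter>{W. W \<subseteq> valuations D le \<and> simple_valuations D le \<subseteq> W \<and>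
     (\<forall>S s. S \<subseteq> W \<and> directed_in (valuations D le) (stochastic_le D le) S \<and>
            is_lub_in (valuations D le) (stochastic_le D le) S s \<longrightarrow> s \<in> W)}"

definition valuation_kegel :: "'a set \<Rightarrow> ('a \<Rightarrow> 'a \<Rightarrow> bool) \<Rightarrow> ('a set \<Rightarrow> real) kegel" where
  "valuation_kegel D le =
     \<lparr> kset = minimal_valuations D le,
       kle = stochastic_le D le,
       kbot = (\<lambda>U. 0),
       kcomb = (\<lambda>r \<mu> \<nu> U. r * \<mu> U + (1 - r) * \<nu> U) \<rparr>"

subsection \<open>Operator algebras and their morphisms\<close>

(* Addition and multiplication are those of the ambient ring type; the unit is a separate field
   because the unit of l^infty(X) is the indicator of X rather than the constant function 1. *)
record 'b star_alg =
  elems :: "'b set"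
  scal :: "complex \<Rightarrow> 'b \<Rightarrow> 'b"
  adj :: "'b \<Rightarrow> 'b"
  unt :: 'b

definition complex_alg :: "complex star_alg" where
  "complex_alg = \<lparr> elems = UNIV, scal = (*), adj = cnj, unt = 1 \<rparr>"

definition linf :: "'a set \<Rightarrow> ('a \<Rightarrow> complex) star_alg" where
  "linf X =
     \<lparr> elems = {f. bounded (f ` X) \<and> (\<forall>x. x \<notin> X \<longrightarrow> f x = 0)},
       scal = (\<lambda>c f x. c * f x),
       adj = (\<lambda>f x. cnj (f x)),
       unt = indicator X \<rparr>"

(* Positivity in the n-by-n matrices over A: the matrix M is of the form N^* N. *)
definition mat_positive :: "'b::ring star_alg \<Rightarrow> nat \<Rightarrow> (nat \<Rightarrow> nat \<Rightarrow> 'b) \<Rightarrow> bool" where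
  "mat_positive A n M \<longleftrightarrow>
     (\<exists>N. (\<forall>i<n. \<forall>j<n. N i j \<in> elems A) \<and>
          (\<forall>i<n. \<forall>j<n. M i j = (\<Sum>k<n. adj A (N k i) * N k j)))"

definition completely_positive ::
  "'b::ring star_alg \<Rightarrow> 'c::ring star_alg \<Rightarrow> ('b \<Rightarrow> 'c) \<Rightarrow> bool" where
  "completely_positive A B \<phi> \<longleftrightarrow>
     (\<forall>n M. (\<forall>i<n. \<forall>j<n. M i j \<in> elems A) \<and> mat_positive A n M \<longrightarrow>
            mat_positive B n (\<lambda>i j. \<phi> (M i j)))"

definition alg_positive :: "'b::ring star_alg \<Rightarrow> 'b \<Rightarrow> bool" where
  "alg_positive A a \<longleftrightarrow> (\<exists>b\<in>elems A. a = adj A b * b)"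

definition alg_le :: "'b::ring star_alg \<Rightarrow> 'b \<Rightarrow> 'b \<Rightarrow> bool" where
  "alg_le A a b \<longleftrightarrow> alg_positive A (b - a)"

definition self_adjoint :: "'b star_alg \<Rightarrow> 'b set" where
  "self_adjoint A = {a \<in> elems A. adj A a = a}"

definition alg_linear :: "'b::ring star_alg \<Rightarrow> 'c::ring star_alg \<Rightarrow> ('b \<Rightarrow> 'c) \<Rightarrow> bool" where
  "alg_linear A B \<phi> \<longleftrightarrow>
     \<phi> \<in> elems A \<rightarrow> elems B \<and> (\<forall>a. a \<notin> elems A \<longrightarrow> \<phi> a = 0) \<and>
     (\<forall>a\<in>elems A. \<forall>b\<in>elems A. \<phi> (a + b) = \<phi> a + \<phi> b) \<and>
     (\<forall>c. \<forall>a\<in>elems A. \<phi> (scal A c a) = scal B c (\<phi> a))"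

(* Normality of a positive map: it preserves suprema of bounded directed sets of self-adjoint
   elements (such suprema always exist in a von Neumann algebra). *)
definition normal_map :: "'b::ring star_alg \<Rightarrow> 'c::ring star_alg \<Rightarrow> ('b \<Rightarrow> 'c) \<Rightarrow> bool" where
  "normal_map A B \<phi> \<longleftrightarrow>
     scott_continuous_on (self_adjoint A) (alg_le A) (self_adjoint B) (alg_le B) \<phi>"

definition subunital :: "'b::ring star_alg \<Rightarrow> 'c::ring star_alg \<Rightarrow> ('b \<Rightarrow> 'c) \<Rightarrow> bool" where
  "subunital A B \<phi> \<longleftrightarrow> alg_le B (\<phi> (unt A)) (unt B)"

(* Q is an opposite category: a morphism from B to A is a map of algebras from A to B. *)
definition Q_hom :: "'c::ring star_alg \<Rightarrow> 'b::ring star_alg \<Rightarrow> ('b \<Rightarrow> 'c) set" where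
  "Q_hom B A =
     {\<phi>. alg_linear A B \<phi> \<and> normal_map A B \<phi> \<and> completely_positive A B \<phi> \<and> subunital A B \<phi>}"

definition Q_kegel :: "'c::ring star_alg \<Rightarrow> 'b::ring star_alg \<Rightarrow> ('b \<Rightarrow> 'c) kegel" where
  "Q_kegel B A =
     \<lparr> kset = Q_hom B A,
       kle = (\<lambda>\<phi> \<psi>. completely_positive A B (\<lambda>a. \<psi> a - \<phi> a)),
       kbot = (\<lambda>a. 0),
       kcomb = (\<lambda>r \<phi> \<psi> a. scal B (of_real r) (\<phi> a) + scal B (of_real (1 - r)) (\<psi> a)) \<rparr>"

definition normal_unital_star_homs ::
  "'b::ring star_alg \<Rightarrow> 'c::ring star_alg \<Rightarrow> ('b \<Rightarrow> 'c) set" where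
  "normal_unital_star_homs A B =
     {\<phi>. alg_linear A B \<phi> \<and> normal_map A B \<phi> \<and>
         (\<forall>a\<in>elems A. \<forall>b\<in>elems A. \<phi> (a * b) = \<phi> a * \<phi> b) \<and>
         (\<forall>a\<in>elems A. \<phi> (adj A a) = adj B (\<phi> a)) \<and>
         \<phi> (unt A) = unt B}"

end

(* A subprobability weight on X is a function p >= 0 vanishing off X all of whose finite sums are at
   most 1.  Ordered pointwise these form a continuous Kegelspitze: scaling p by some t < 1 and cutting
   it off outside a finite set yields elements way below p with supremum p.  Both Kegelspitzen of the
   theorem are order-isomorphic to it.  Every subset of X is Scott-open, so a valuation is determined
   by its point masses, and it is the directed supremum of its (simple) restrictions to finite sets.
   A normal functional on l^infty(X) is determined by its values on the indicators of points, because
   a positive f is the directed supremum of its restrictions to finite sets; conversely p acts by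
   f |-> sum p(x) f(x).  Complete positivity is automatic for positive functionals, because positive
   semidefinite scalar matrices are Gram matrices.  A multiplicative functional has point masses in
   {0, 1} with sum 1, that is, a single point. *)

theory Submission imports Defs begin

subsection \<open>Order isomorphisms\<close>

text \<open>Suprema are least upper bounds within a carrier, so nothing says a priori that they are
  pointwise, yet every epsilon argument needs that. It holds once the carrier contains the pointwise
  supremum of the directed set: for weights because finite sums commute with directed suprema, for
  bounded functions because that supremum is squeezed between a member and the given bound. The
  analysis is therefore done for real functions only. Suprema in the two Kegelspitzen of the theorem
  are never computed but transported along order isomorphisms, and normality is likewise transported
  from real functions to self-adjoint elements. As \<open>X\<close> may be uncountable, sequences do
  not suffice: sums are unordered, and directedness provides one member of the family that is good
  at finitely many points at once.\<close>

definition order_iso_on ::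
  "'a set \<Rightarrow> ('a \<Rightarrow> 'a \<Rightarrow> bool) \<Rightarrow> 'b set \<Rightarrow> ('b \<Rightarrow> 'b \<Rightarrow> bool) \<Rightarrow> ('a \<Rightarrow> 'b) \<Rightarrow> bool" where
  "order_iso_on D leD E leE h \<longleftrightarrow>
     bij_betw h D E \<and> (\<forall>a\<in>D. \<forall>b\<in>D. leD a b \<longleftrightarrow> leE (h a) (h b))"

lemma order_iso_on_inv_into:
  assumes "order_iso_on D leD E leE h"
  shows "order_iso_on E leE D leD (inv_into D h)"
proof -
  have h: "bij_betw h D E" using assms by (simp add: order_iso_on_def)
  have "inv_into D h a \<in> D \<and> h (inv_into D h a) = a" if "a \<in> E" for a
    using h that by (simp add: bij_betw_inv_into_right bij_betw_apply[OF bij_betw_inv_into])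
  then have "leE a b \<longleftrightarrow> leD (inv_into D h a) (inv_into D h b)" if "a \<in> E" "b \<in> E" for a b
    using assms that unfolding order_iso_on_def by (metis (no_types))
  then show ?thesis
    using bij_betw_inv_into[OF h] by (simp add: order_iso_on_def)
qed

lemma order_iso_on_prod:
  assumes "order_iso_on D leD E leE h" "order_iso_on D' leD' E' leE' h'"
  shows "order_iso_on (D \<times> D') (prod_le leD leD') (E \<times> E') (prod_le leE leE') (map_prod h h')"
  using assms unfolding order_iso_on_def prod_le_def
  by (auto intro: bij_betw_map_prod)

text \<open>Serves the scalar factor \<open>{0..1}\<close> in the continuity axiom for
  \<open>(r, a)\<close>, which stays fixed when one Kegelspitze is exchanged for another.\<close>

lemma order_iso_on_id: "order_iso_on D le D le id"
  by (simp add: order_iso_on_def)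

lemma directed_in_image:
  assumes h: "order_iso_on D leD E leE h" and S: "directed_in D leD S"
  shows "directed_in E leE (h ` S)"
  unfolding directed_in_def
proof (intro conjI ballI)
  show "h ` S \<subseteq> E" "h ` S \<noteq> {}"
    using h S by (auto simp: order_iso_on_def directed_in_def bij_betw_def)
  fix a b assume "a \<in> h ` S" "b \<in> h ` S"
  then obtain a' b' where *: "a = h a'" "b = h b'" "a' \<in> S" "b' \<in> S" by auto
  then obtain c where "c \<in> S" "leD a' c" "leD b' c"
    using S unfolding directed_in_def by blast
  then show "\<exists>c\<in>h ` S. leE a c \<and> leE b c"
    using * h S unfolding order_iso_on_def directed_in_def by (metis imageI subsetD)
qed

text \<open>Surjectivity of \<open>h\<close> is essential: every rival upper bound in
  \<open>E\<close> is the image of one in \<open>D\<close>. A mere order embedding need not preserve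
  suprema.\<close>

lemma is_lub_in_image:
  assumes h: "order_iso_on D leD E leE h" and S: "S \<subseteq> D" and s: "is_lub_in D leD S s"
  shows "is_lub_in E leE (h ` S) (h s)"
  unfolding is_lub_in_def
proof (intro conjI ballI impI)
  show "h s \<in> E"
    using h s by (auto simp: order_iso_on_def is_lub_in_def bij_betw_def)
  show "leE a (h s)" if "a \<in> h ` S" for a
    using that h S s unfolding order_iso_on_def is_lub_in_def by (metis imageE subsetD)
  fix u assume u: "u \<in> E" "\<forall>a\<in>h ` S. leE a u"
  then obtain v where v: "v \<in> D" "u = h v"
    using h by (auto simp: order_iso_on_def bij_betw_def)
  have "\<forall>a\<in>S. leD a v" using u v h S unfolding order_iso_on_def by blast
  then have "leD s v" using s v by (auto simp: is_lub_in_def)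
  then show "leE (h s) u" using h s v by (auto simp: order_iso_on_def is_lub_in_def)
qed

lemma inv_into_image_image:
  assumes "order_iso_on D leD E leE h" "S \<subseteq> E"
  shows "inv_into D h ` S \<subseteq> D" "h ` inv_into D h ` S = S"
  using assms
  by (auto simp: order_iso_on_def bij_betw_def inv_into_into image_inv_into_cancel)

section \<open>Transport of dcpos, Scott continuity and the way-below relation\<close>

lemma dcpo_on_transfer:
  assumes h: "order_iso_on D leD E leE h" and D: "dcpo_on D leD"
  shows "dcpo_on E leE"
proof -
  have E: "E = h ` D"
    and le: "\<And>a b. a \<in> D \<Longrightarrow> b \<in> D \<Longrightarrow> leE (h a) (h b) \<longleftrightarrow> leD a b"
    using h by (auto simp: order_iso_on_def bij_betw_def)
  have refl: "reflp_on E leE"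
    using D E le by (auto simp: dcpo_on_def reflp_on_def)
  have anti: "antisymp_on E leE"
    using D E le by (auto simp: dcpo_on_def antisymp_on_def)
  have trans: "transp_on E leE"
  proof (rule transp_onI)
    fix x y z assume *: "x \<in> E" "y \<in> E" "z \<in> E" "leE x y" "leE y z"
    obtain a b c where abc: "a \<in> D" "b \<in> D" "c \<in> D" "x = h a" "y = h b" "z = h c"
      using *(1-3) unfolding E by blast
    then have "leD a c"
      using * D transp_onD[of D leD a b c] by (simp add: dcpo_on_def le)
    then show "leE x z" using abc le by simp
  qed
  have "\<exists>s. is_lub_in E leE S s" if S: "directed_in E leE S" for S
  proof -
    have "directed_in D leD (inv_into D h ` S)"
      using directed_in_image[OF order_iso_on_inv_into[OF h] S] .
    then obtain s where "is_lub_in D leD (inv_into D h ` S) s"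
      using D by (auto simp: dcpo_on_def)
    then have "is_lub_in E leE (h ` inv_into D h ` S) (h s)"
      using is_lub_in_image[OF h] inv_into_image_image(1)[OF h] S
      by (auto simp: directed_in_def)
    then show ?thesis
      using inv_into_image_image(2)[OF h] S by (auto simp: directed_in_def)
  qed
  with refl anti trans show ?thesis by (simp add: dcpo_on_def)
qed

text \<open>Asks for a commuting square rather than for \<open>g\<close> as a conjugate of
  \<open>f\<close>, because \<open>g\<close> is always given in its own right: as an operation of
  the second Kegelspitze, or as a functional whose normality is in question.\<close>

lemma scott_continuous_on_transfer:
  assumes h: "order_iso_on D leD D' leD' h" and k: "order_iso_on E leE E' leE' k"
    and f: "scott_continuous_on D leD E leE f"
    and fg: "\<And>a. a \<in> D \<Longrightarrow> g (h a) = k (f a)"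
  shows "scott_continuous_on D' leD' E' leE' g"
  unfolding scott_continuous_on_def
proof (intro conjI allI impI; (elim conjE)?)
  have D': "D' = h ` D" using h by (auto simp: order_iso_on_def bij_betw_def)
  have fE: "f \<in> D \<rightarrow> E" using f by (auto simp: scott_continuous_on_def)
  show "g \<in> D' \<rightarrow> E'"
    using fE k fg by (auto simp: D' order_iso_on_def bij_betw_def)
  fix S s assume S: "directed_in D' leD' S" and s: "is_lub_in D' leD' S s"
  define T where "T = inv_into D h ` S"
  define t where "t = inv_into D h s"
  have SD: "S \<subseteq> D'" using S by (simp add: directed_in_def)
  have T: "directed_in D leD T"
    using directed_in_image[OF order_iso_on_inv_into[OF h] S] by (simp add: T_def)
  have t: "is_lub_in D leD T t"
    using is_lub_in_image[OF order_iso_on_inv_into[OF h] SD s] by (simp add: T_def t_def)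
  have TD: "T \<subseteq> D" using T by (simp add: directed_in_def)
  have ST: "S = h ` T" using inv_into_image_image(2)[OF h SD] by (simp add: T_def)
  have st: "s = h t"
    using s h unfolding t_def is_lub_in_def order_iso_on_def
    by (metis bij_betw_inv_into_right)
  have "is_lub_in E leE (f ` T) (f t)"
    using f T t by (auto simp: scott_continuous_on_def)
  then have "is_lub_in E' leE' (k ` f ` T) (k (f t))"
    by (rule is_lub_in_image[OF k, rotated]) (use fE TD in auto)
  moreover have "k ` f ` T = g ` S"
    unfolding ST image_image using fg TD by (auto intro!: image_cong)
  moreover have "k (f t) = g s"
    using fg t by (simp add: st is_lub_in_def)
  ultimately show "is_lub_in E' leE' (g ` S) (g s)" by simp
qed

text \<open>One implication is enough; the reverse one is the same lemma applied to the inverse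
  isomorphism.\<close>

lemma way_below_transfer:
  assumes h: "order_iso_on D leD E leE h" and "x \<in> D" "y \<in> D" and w: "way_below D leD x y"
  shows "way_below E leE (h x) (h y)"
  unfolding way_below_def
proof (intro allI impI; elim conjE)
  fix S s assume S: "directed_in E leE S" and s: "is_lub_in E leE S s" and le: "leE (h y) s"
  let ?k = "inv_into D h"
  have SE: "S \<subseteq> E" using S by (simp add: directed_in_def)
  have k: "order_iso_on E leE D leD ?k" by (rule order_iso_on_inv_into[OF h])
  have *: "?k s \<in> D" "h (?k s) = s"
    using h s by (auto simp: order_iso_on_def is_lub_in_def bij_betw_def inv_into_into f_inv_into_f)
  have "leD y (?k s)"
    using le * h \<open>y \<in> D\<close> by (auto simp: order_iso_on_def)
  then obtain d where d: "d \<in> ?k ` S" "leD x d"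
    using w directed_in_image[OF k S] is_lub_in_image[OF k SE s] unfolding way_below_def by blast
  have "d \<in> D" using d inv_into_image_image(1)[OF h SE] by blast
  moreover have "h d \<in> S" using d inv_into_image_image(2)[OF h SE] by blast
  ultimately show "\<exists>d\<in>S. leE (h x) d"
    using d h \<open>x \<in> D\<close> by (auto simp: order_iso_on_def)
qed

lemma continuous_dcpo_on_transfer:
  assumes h: "order_iso_on D leD E leE h" and D: "continuous_dcpo_on D leD"
  shows "continuous_dcpo_on E leE"
  unfolding continuous_dcpo_on_def
proof (intro conjI ballI)
  show "dcpo_on E leE"
    using dcpo_on_transfer[OF h] D by (simp add: continuous_dcpo_on_def)
  fix y assume "y \<in> E"
  then obtain x where x: "x \<in> D" "y = h x" using h by (auto simp: order_iso_on_def bij_betw_def)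
  have E: "E = h ` D" and inj: "inj_on h D" using h by (auto simp: order_iso_on_def bij_betw_def)
  have "{z \<in> E. way_below E leE z y} = h ` {z \<in> D. way_below D leD z x}"
  proof (intro equalityI subsetI)
    fix z assume "z \<in> {z \<in> E. way_below E leE z y}"
    then obtain w where w: "w \<in> D" "z = h w" "way_below E leE (h w) (h x)"
      using E x by auto
    have "way_below D leD (inv_into D h (h w)) (inv_into D h (h x))"
      using way_below_transfer[OF order_iso_on_inv_into[OF h]] w x E by blast
    then show "z \<in> h ` {z \<in> D. way_below D leD z x}"
      using w x inj by auto
  qed (use way_below_transfer[OF h] x E in auto)
  moreover have "directed_in D leD {z \<in> D. way_below D leD z x}"
    "is_lub_in D leD {z \<in> D. way_below D leD z x} x"
    using D x by (auto simp: continuous_dcpo_on_def)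
  ultimately show "directed_in E leE {z \<in> E. way_below E leE z y}"
    "is_lub_in E leE {z \<in> E. way_below E leE z y} y"
    using directed_in_image[OF h] is_lub_in_image[OF h] x by auto
qed

section \<open>Transport of Kegelspitzen\<close>

lemma kegelspitze_iso_order_iso_on:
  "kegelspitze_iso K L h \<Longrightarrow> order_iso_on (kset K) (kle K) (kset L) (kle L) h"
  by (simp add: kegelspitze_iso_def order_iso_on_def)

text \<open>Closure is not an axiom of its own in \<open>kegelspitze\<close>; it is the typing part
  of Scott continuity of the combination map.\<close>

lemma kegelspitze_comb_closed:
  assumes "kegelspitze K" "r \<in> {0..1}" "a \<in> kset K" "b \<in> kset K"
  shows "kcomb K r a b \<in> kset K"
proof -
  have "(\<lambda>(a, b). kcomb K r a b) \<in> kset K \<times> kset K \<rightarrow> kset K"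
    using assms unfolding kegelspitze_def scott_continuous_on_def by blast
  then have "(\<lambda>(a, b). kcomb K r a b) (a, b) \<in> kset K"
    using assms by blast
  then show ?thesis by simp
qed

lemma kegelspitze_transfer:
  assumes h: "kegelspitze_iso K L h" and K: "kegelspitze K"
  shows "kegelspitze L"
proof -
  let ?A = "kset K"
  note o = kegelspitze_iso_order_iso_on[OF h]
  have L: "kset L = h ` ?A" using h by (auto simp: kegelspitze_iso_def bij_betw_def)
  have comb: "kcomb L r (h a) (h b) = h (kcomb K r a b)"
    if "r \<in> {0..1}" "a \<in> ?A" "b \<in> ?A" for r a b
    using h that by (auto simp: kegelspitze_iso_def)
  have bot: "kbot L = h (kbot K)" using h by (simp add: kegelspitze_iso_def)
  have botK: "kbot K \<in> ?A" using K by (simp add: kegelspitze_def)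
  note cl = kegelspitze_comb_closed[OF K]
  have assoc: "kcomb L r (kcomb L p (h a) (h b)) (h c) =
        kcomb L (p * r) (h a) (kcomb L ((r - p * r) / (1 - p * r)) (h b) (h c))"
    if "p \<in> {0..<1}" "r \<in> {0..<1}" "a \<in> ?A" "b \<in> ?A" "c \<in> ?A" for p r a b c
  proof -
    \<comment> \<open>\<open>h\<close> preserves combinations only for weights in the unit interval,
      so both weights on the right-hand side of associativity have to be placed there.\<close>
    have pr: "0 \<le> p * r" "p * r \<le> r" "p * r \<in> {0..1}"
      using that mult_left_le_one_le[of r p] by auto
    have q: "(r - p * r) / (1 - p * r) \<in> {0..1}"
      using pr(2) that by (simp add: divide_le_eq)
    have eq: "kcomb K r (kcomb K p a b) c =
        kcomb K (p * r) a (kcomb K ((r - p * r) / (1 - p * r)) b c)"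
      using K that unfolding kegelspitze_def by blast
    have r: "r \<in> {0..1}" "p \<in> {0..1}" using that by auto
    show ?thesis
      by (simp only: comb cl r pr(3) q that eq)
  qed
  have ax: "kcomb K 1 a b = a" "kcomb K r a a = a" "kcomb K r a b = kcomb K (1 - r) b a"
    if "r \<in> {0..1}" "a \<in> ?A" "b \<in> ?A" for r a b
    using K that unfolding kegelspitze_def by blast+
  have "scott_continuous_on (kset L \<times> kset L) (prod_le (kle L) (kle L)) (kset L) (kle L)
      (\<lambda>(a, b). kcomb L r a b)" if "r \<in> {0..1}" for r
  proof (rule scott_continuous_on_transfer[OF order_iso_on_prod[OF o o] o])
    show "scott_continuous_on (?A \<times> ?A) (prod_le (kle K) (kle K)) ?A (kle K) (\<lambda>(a, b). kcomb K r a b)"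
      using K that by (auto simp: kegelspitze_def)
  qed (use that comb in auto)
  moreover have "scott_continuous_on ({0..1} \<times> kset L) (prod_le (\<le>) (kle L)) (kset L) (kle L)
      (\<lambda>(r, a). kcomb L r a (kbot L))"
  proof (rule scott_continuous_on_transfer[OF order_iso_on_prod[OF order_iso_on_id o] o])
    show "scott_continuous_on ({0..1} \<times> ?A) (prod_le (\<le>) (kle K)) ?A (kle K)
        (\<lambda>(r, a). kcomb K r a (kbot K))"
      using K by (auto simp: kegelspitze_def)
  qed (use comb bot botK in auto)
  moreover have "dcpo_on (kset L) (kle L)"
    using dcpo_on_transfer[OF o] K by (simp add: kegelspitze_def)
  moreover have "kcomb L r a b = kcomb L (1 - r) b a" "kcomb L r a a = a" "kcomb L 1 a b = a"
    if r: "r \<in> {0..1}" and ab: "a \<in> kset L" "b \<in> kset L" for r a b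
  proof -
    obtain x y where [simp]: "a = h x" "b = h y" and xy: "x \<in> ?A" "y \<in> ?A"
      using ab L by auto
    have "1 - r \<in> {0..1}" using r by auto
    then show "kcomb L r a b = kcomb L (1 - r) b a" "kcomb L r a a = a" "kcomb L 1 a b = a"
      using ax[OF r xy] ax[of 1 x y] r xy by (simp_all add: comb)
  qed
  moreover have "kcomb L r (kcomb L p a b) c =
        kcomb L (p * r) a (kcomb L ((r - p * r) / (1 - p * r)) b c)"
    if "p \<in> {0..<1}" "r \<in> {0..<1}" "a \<in> kset L" "b \<in> kset L" "c \<in> kset L" for p r a b c
    using assoc that unfolding L by blast
  moreover have "kbot L \<in> kset L" using L bot botK by blast
  \<comment> \<open>The fact about \<open>kcomb L 1\<close> was recorded under a hypothesis on an
    unrelated \<open>r\<close>; this is a witness for it.\<close>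
  moreover have "(1::real) \<in> {0..1}" by simp
  ultimately show ?thesis
    unfolding kegelspitze_def by (intro conjI ballI) (assumption | blast)+
qed

lemma continuous_kegelspitze_transfer:
  assumes "kegelspitze_iso K L h" "continuous_kegelspitze K"
  shows "continuous_kegelspitze L"
  using assms kegelspitze_transfer continuous_dcpo_on_transfer kegelspitze_iso_order_iso_on
  unfolding continuous_kegelspitze_def by blast

text \<open>Two isomorphisms out of a common source give the map of the theorem. That
  \<open>K\<close> is a Kegelspitze guarantees that \<open>kbot K\<close> and all combinations lie
  in \<open>kset K\<close>, where the inverse of \<open>h\<close> cancels.\<close>

lemma kegelspitze_iso_inv_comp:
  assumes h: "kegelspitze_iso K L h" and g: "kegelspitze_iso K M g" and K: "kegelspitze K"
  shows "kegelspitze_iso L M (g \<circ> inv_into (kset K) h)"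
proof -
  let ?k = "inv_into (kset K) h"
  have L: "kset L = h ` kset K" and k: "\<And>a. a \<in> kset K \<Longrightarrow> ?k (h a) = a"
    using h by (auto simp: kegelspitze_iso_def bij_betw_def)
  have "bij_betw (g \<circ> ?k) (kset L) (kset M)"
    using h g by (auto simp: kegelspitze_iso_def intro: bij_betw_trans bij_betw_inv_into)
  moreover have "kbot L = h (kbot K)" "kbot K \<in> kset K" "g (kbot K) = kbot M"
    using h g K unfolding kegelspitze_iso_def kegelspitze_def by metis+
  moreover have "kcomb L r (h a) (h b) = h (kcomb K r a b)"
    if "r \<in> {0..1}" "a \<in> kset K" "b \<in> kset K" for r a b
    using h that by (auto simp: kegelspitze_iso_def)
  moreover have "kle L (h a) (h b) \<longleftrightarrow> kle M (g a) (g b)"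
    if "a \<in> kset K" "b \<in> kset K" for a b
    using h g that by (simp add: kegelspitze_iso_def)
  moreover have "g (kcomb K r a b) = kcomb M r (g a) (g b)"
    if "r \<in> {0..1}" "a \<in> kset K" "b \<in> kset K" for r a b
    using g that by (simp add: kegelspitze_iso_def)
  ultimately show ?thesis
    using kegelspitze_comb_closed[OF K]
    unfolding kegelspitze_iso_def L by (simp add: k)
qed

subsection \<open>Directed suprema of real functions\<close>

lemma is_lub_in_unit_intervalD:
  fixes a :: real
  assumes "directed_in {0..1} (\<le>) A" "is_lub_in {0..1} (\<le>) A a" "e > 0"
  shows "\<exists>b\<in>A. a - e < b"
proof (rule ccontr)
  assume "\<not> ?thesis"
  then have *: "\<forall>b\<in>A. b \<le> a - e" by (auto simp: not_less)
  \<comment> \<open>The rival bound \<open>a - e\<close> must itself lie in the unit interval; an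
    element of the nonempty set \<open>A\<close> below it shows that it is nonnegative.\<close>
  obtain b where "b \<in> A" "b \<ge> 0" using assms(1) by (force simp: directed_in_def)
  then have "a - e \<in> {0..1}" using * assms(2,3) by (fastforce simp: is_lub_in_def)
  then have "a \<le> a - e" using assms(2) * by (auto simp: is_lub_in_def)
  then show False using \<open>e > 0\<close> by simp
qed

text \<open>The hypotheses say that \<open>s\<close> is the pointwise supremum of \<open>S\<close>,
  which lies below every upper bound, inside \<open>D\<close> or not.\<close>

lemma is_lub_in_funI:
  fixes s :: "'a \<Rightarrow> real"
  assumes s: "s \<in> D" and up: "\<And>a. a \<in> S \<Longrightarrow> a \<le> s"
    and app: "\<And>x e. e > 0 \<Longrightarrow> \<exists>a\<in>S. s x - e < a x"
  shows "is_lub_in D (\<le>) S s"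
proof -
  have "s x \<le> u x" if u: "\<forall>b\<in>S. b \<le> u" for u x
  proof (rule field_le_epsilon)
    fix e :: real assume "e > 0"
    obtain b where b: "b \<in> S" "s x - e < b x" using app[OF \<open>e > 0\<close>, of x] ..
    then have "b x \<le> u x" using u by (simp add: le_funD)
    then show "s x \<le> u x + e" using b(2) by linarith
  qed
  then have "s \<le> u" if "\<forall>b\<in>S. b \<le> u" for u
    using that by (intro le_funI)
  with s up show ?thesis unfolding is_lub_in_def by (intro conjI ballI impI)
qed

text \<open>The pointwise supremum \<open>t\<close> of \<open>S\<close> is a rival upper bound as
  soon as it lies in \<open>D\<close>, and then \<open>s = t\<close>. The premise \<open>cl\<close>
  asks for exactly this membership and offers \<open>t \<le> s\<close> as a further assumption,
  which is what bounds \<open>t\<close> when the carrier is not closed under unbounded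
  suprema.\<close>

lemma is_lub_in_funD:
  fixes s :: "'a \<Rightarrow> real"
  assumes S: "S \<noteq> {}" and s: "is_lub_in D (\<le>) S s"
    and cl: "\<And>t. (\<And>a. a \<in> S \<Longrightarrow> a \<le> t) \<Longrightarrow> (\<And>x e. e > 0 \<Longrightarrow> \<exists>a\<in>S. t x - e < a x) \<Longrightarrow> t \<le> s \<Longrightarrow> t \<in> D"
    and "e > 0"
  shows "\<exists>a\<in>S. s x - e < a x"
proof -
  define t where "t x = (SUP a\<in>S. a x)" for x
  have up: "a \<le> s" if "a \<in> S" for a using that s by (simp add: is_lub_in_def)
  have bdd: "bdd_above ((\<lambda>a. a x) ` S)" for x
    by (rule bdd_aboveI2[where M="s x"]) (use up in \<open>auto simp: le_fun_def\<close>)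
  have t1: "a \<le> t" if "a \<in> S" for a
    unfolding t_def using that bdd by (auto simp: le_fun_def intro: cSUP_upper)
  have t2: "\<exists>a\<in>S. t x - e < a x" if "e > 0" for x e
    using less_cSUP_iff[OF S bdd, of "t x - e" x] that by (simp add: t_def)
  have "t \<le> s"
    unfolding t_def using S up by (auto simp: le_fun_def intro!: cSUP_least)
  then have "t \<in> D" using cl t1 t2 by blast
  then have "s \<le> t" using s t1 by (auto simp: is_lub_in_def)
  then have "s x \<le> t x" by (rule le_funD)
  obtain a where "a \<in> S" "t x - e < a x" using t2[OF \<open>e > 0\<close>, of x] ..
  then show ?thesis using \<open>s x \<le> t x\<close> by (intro bexI[of _ a]) linarith+
qed

text \<open>Witnesses for single points are joined one at a time by directedness. The anchor
  \<open>a0\<close> starts the induction and also makes the result dominate a chosen element, so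
  that differences from it are nonnegative.\<close>

lemma directed_finite_approx:
  fixes t :: "'a \<Rightarrow> real"
  assumes S: "directed_in D (\<le>) S"
    and app: "\<And>x. x \<in> F \<Longrightarrow> \<exists>a\<in>S. t x < a x" and "finite F" and a0: "a0 \<in> S"
  shows "\<exists>a\<in>S. a0 \<le> a \<and> (\<forall>x\<in>F. t x < a x)"
  using \<open>finite F\<close> app
proof (induction F)
  case (insert y F)
  then obtain a where a: "a \<in> S" "a0 \<le> a" "\<forall>x\<in>F. t x < a x" by auto
  obtain b where b: "b \<in> S" "t y < b y" using insert.prems by auto
  obtain c where "c \<in> S" "a \<le> c" "b \<le> c" using S a(1) b(1) unfolding directed_in_def by blast
  moreover have "a0 \<le> c" using a(2) \<open>a \<le> c\<close> by (rule order_trans)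
  moreover have "t x < c x" if "x \<in> insert y F" for x
    using that a(3) b(2) le_funD[OF \<open>a \<le> c\<close>, of x] le_funD[OF \<open>b \<le> c\<close>, of x] by force
  ultimately show ?case by blast
qed (use a0 in auto)

section \<open>Directed sets and suprema in products\<close>

lemma directed_in_fst_snd:
  assumes "directed_in (D \<times> E) (prod_le leD leE) S"
  shows "directed_in D leD (fst ` S)" "directed_in E leE (snd ` S)"
proof -
  have ub: "\<exists>c\<in>S. prod_le leD leE a c \<and> prod_le leD leE b c" if "a \<in> S" "b \<in> S" for a b
    using assms that by (auto simp: directed_in_def)
  have "S \<subseteq> D \<times> E" "S \<noteq> {}" using assms by (auto simp: directed_in_def)
  moreover have "\<exists>c\<in>fst ` S. leD a c \<and> leD b c" if "a \<in> fst ` S" "b \<in> fst ` S" for a b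
    using that ub unfolding prod_le_def by (elim imageE) blast
  moreover have "\<exists>c\<in>snd ` S. leE a c \<and> leE b c" if "a \<in> snd ` S" "b \<in> snd ` S" for a b
    using that ub unfolding prod_le_def by (elim imageE) blast
  ultimately show "directed_in D leD (fst ` S)" "directed_in E leE (snd ` S)"
    by (auto simp: directed_in_def)
qed

lemma is_lub_in_fst_snd:
  assumes S: "S \<subseteq> D \<times> E" and s: "is_lub_in (D \<times> E) (prod_le leD leE) S s"
  shows "is_lub_in D leD (fst ` S) (fst s)" "is_lub_in E leE (snd ` S) (snd s)"
proof -
  have *: "fst s \<in> D" "snd s \<in> E" "\<forall>a\<in>S. leD (fst a) (fst s)" "\<forall>a\<in>S. leE (snd a) (snd s)"
    using s by (auto simp: is_lub_in_def prod_le_def)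
  \<comment> \<open>The rival bound in the product is \<open>(u, snd s)\<close>; the second
    projection is treated symmetrically.\<close>
  have "leD (fst s) u" if "u \<in> D" "\<forall>a\<in>fst ` S. leD a u" for u
    using s that * unfolding is_lub_in_def prod_le_def
    by (metis SigmaI fst_conv snd_conv imageI)
  then show "is_lub_in D leD (fst ` S) (fst s)" using * by (auto simp: is_lub_in_def)
  have "leE (snd s) u" if "u \<in> E" "\<forall>a\<in>snd ` S. leE a u" for u
    using s that * unfolding is_lub_in_def prod_le_def
    by (metis SigmaI fst_conv snd_conv imageI)
  then show "is_lub_in E leE (snd ` S) (snd s)" using * by (auto simp: is_lub_in_def)
qed

subsection \<open>Subprobability weights\<close>

text \<open>The mass is bounded through finite partial sums and not through \<open>infsum\<close>,
  whose default value 0 on non-summable functions would make such a bound meaningless. Summability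
  becomes a consequence.\<close>

definition subprobs :: "'a set \<Rightarrow> ('a \<Rightarrow> real) set" where
  "subprobs X = {p. (\<forall>x. 0 \<le> p x) \<and> (\<forall>x. x \<notin> X \<longrightarrow> p x = 0) \<and> (\<forall>F. finite F \<longrightarrow> sum p F \<le> 1)}"

definition subprob_kegel :: "'a set \<Rightarrow> ('a \<Rightarrow> real) kegel" where
  "subprob_kegel X = \<lparr> kset = subprobs X, kle = (\<le>), kbot = (\<lambda>x. 0),
     kcomb = (\<lambda>r p q x. r * p x + (1 - r) * q x) \<rparr>"

lemma subprobsD:
  assumes "p \<in> subprobs X"
  shows "0 \<le> p x" "x \<notin> X \<Longrightarrow> p x = 0" "finite F \<Longrightarrow> sum p F \<le> 1" "p x \<le> 1"
  using assms sum.insert[of "{}" x p] unfolding subprobs_def by (auto dest: spec[of _ "{x}"])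

lemma subprobs_down:
  assumes "p \<in> subprobs X" "\<And>x. 0 \<le> q x" "q \<le> p"
  shows "q \<in> subprobs X"
proof -
  have "q x = 0" if "x \<notin> X" for x
    using assms(2)[of x] le_funD[OF assms(3), of x] subprobsD(2)[OF assms(1) that] by simp
  moreover have "sum q F \<le> 1" if "finite F" for F
    using sum_mono[of F q p] subprobsD(3)[OF assms(1) that] assms(3) by (auto simp: le_fun_def)
  ultimately show ?thesis using assms by (auto simp: subprobs_def)
qed

lemma zero_in_subprobs: "(\<lambda>x. 0) \<in> subprobs X"
  by (simp add: subprobs_def)

lemma subprobs_comb:
  assumes "r \<in> {0..1}" and p: "p \<in> subprobs X" and q: "q \<in> subprobs X"
  shows "(\<lambda>x. r * p x + (1 - r) * q x) \<in> subprobs X"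
proof -
  have "(\<Sum>x\<in>F. r * p x + (1 - r) * q x) \<le> 1" if "finite F" for F
    using convex_bound_le[OF subprobsD(3)[OF p that] subprobsD(3)[OF q that], of r "1 - r"] assms(1)
    by (simp add: sum.distrib sum_distrib_left)
  then show ?thesis using assms by (auto simp: subprobs_def)
qed

text \<open>A finite sum sees finitely many points, and directedness yields one member of
  \<open>S\<close> close to \<open>t\<close> at all of them. For a family that is not directed the
  mass of the pointwise supremum could exceed 1.\<close>

lemma subprobs_pointwise_sup:
  assumes S: "directed_in (subprobs X) (\<le>) S"
    and up: "\<And>a. a \<in> S \<Longrightarrow> a \<le> t"
    and app: "\<And>x e. e > 0 \<Longrightarrow> \<exists>a\<in>S. t x - e < a x"
  shows "t \<in> subprobs X"
proof -
  obtain a0 where a0: "a0 \<in> S" using S by (auto simp: directed_in_def)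
  have SP: "a \<in> subprobs X" if "a \<in> S" for a using S that by (auto simp: directed_in_def)
  have pos: "0 \<le> t x" for x
    using subprobsD(1)[OF SP[OF a0], of x] up[OF a0] by (meson le_funD order_trans)
  have off: "t x = 0" if x: "x \<notin> X" for x
  proof (rule ccontr)
    assume "t x \<noteq> 0"
    \<comment> \<open>Choosing \<open>t x\<close> itself as the tolerance produces a member of
      \<open>S\<close> that is positive at a point outside \<open>X\<close>.\<close>
    then obtain a where "a \<in> S" "t x - t x < a x" using app[of "t x" x] pos[of x] by auto
    then show False using subprobsD(2)[OF SP[OF \<open>a \<in> S\<close>] x] by simp
  qed
  have "sum t F \<le> 1" if F: "finite F" for F
  proof (rule field_le_epsilon)
    fix e :: real assume e: "e > 0"
    \<comment> \<open>The tolerance is shared among the points of \<open>F\<close>; the added 1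
      keeps the quotient meaningful for empty \<open>F\<close>.\<close>
    define d where "d = e / (card F + 1)"
    have d: "d > 0" using e by (simp add: d_def)
    obtain a where a: "a \<in> S" "\<forall>x\<in>F. t x - d < a x"
      using directed_finite_approx[OF S, of F "\<lambda>x. t x - d" a0] app[OF d] F a0 by blast
    have "sum t F \<le> (\<Sum>x\<in>F. a x + d)" using a by (intro sum_mono) force
    also have "\<dots> = sum a F + card F * d" by (simp add: sum.distrib)
    also have "\<dots> \<le> 1 + e"
      using subprobsD(3)[OF SP[OF a(1)] F] e by (intro add_mono) (auto simp: d_def divide_simps)
    finally show "sum t F \<le> 1 + e" .
  qed
  with pos off show ?thesis by (auto simp: subprobs_def)
qed

lemma subprobs_lubD:
  assumes S: "directed_in (subprobs X) (\<le>) S" and s: "is_lub_in (subprobs X) (\<le>) S s"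
    and e: "e > 0"
  shows "\<exists>a\<in>S. s x - e < a x"
proof (rule is_lub_in_funD[OF _ s _ e])
  show "S \<noteq> {}" using S by (simp add: directed_in_def)
qed (rule subprobs_pointwise_sup[OF S])

section \<open>The Kegelspitze of weights\<close>

lemma dcpo_on_subprobs: "dcpo_on (subprobs X) (\<le>)"
  unfolding dcpo_on_def
proof (intro conjI allI impI)
  fix S assume S: "directed_in (subprobs X) (\<le>) S"
  then have ne: "S \<noteq> {}" and SP: "\<And>a. a \<in> S \<Longrightarrow> a \<in> subprobs X" by (auto simp: directed_in_def)
  define t where "t x = (SUP a\<in>S. a x)" for x
  have bdd: "bdd_above ((\<lambda>a. a x) ` S)" for x
    by (rule bdd_aboveI2[where M=1]) (rule subprobsD(4)[OF SP])
  have t1: "a \<le> t" if "a \<in> S" for a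
    unfolding t_def using that bdd by (auto simp: le_fun_def intro: cSUP_upper)
  have t2: "\<exists>a\<in>S. t x - e < a x" if "e > 0" for x e
    using less_cSUP_iff[OF ne bdd, of "t x - e" x] that by (simp add: t_def)
  have "is_lub_in (subprobs X) (\<le>) S t"
    using subprobs_pointwise_sup[OF S t1 t2] t1 t2 by (intro is_lub_in_funI) auto
  then show "\<exists>s. is_lub_in (subprobs X) (\<le>) S s" by (rule exI[of _ t])
qed (auto simp: reflp_on_def antisymp_on_def transp_on_def)

lemma kegelspitze_subprob: "kegelspitze (subprob_kegel X)"
proof -
  let ?P = "subprobs X"
  have assoc: "r * (p * a x + (1 - p) * b x) + (1 - r) * c x = p * r * a x +
       (1 - p * r) * ((r - p * r) / (1 - p * r) * b x + (1 - (r - p * r) / (1 - p * r)) * c x)"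
    if "p \<in> {0..<1}" "r \<in> {0..<1}" for p r x and a b c :: "'a \<Rightarrow> real"
  proof -
    have "p * r \<le> r" using that mult_left_le_one_le[of r p] by auto
    then have "1 - p * r \<noteq> 0" using that by auto
    then have "(1 - p * r) * ((r - p * r) / (1 - p * r)) = r - p * r" by simp
    then have "(1 - p * r) * ((r - p * r) / (1 - p * r) * b x + (1 - (r - p * r) / (1 - p * r)) * c x)
      = (r - p * r) * b x + ((1 - p * r) - (r - p * r)) * c x"
      by (metis (no_types, opaque_lifting) distrib_left mult.assoc mult.right_neutral right_diff_distrib)
    then show ?thesis by (simp add: algebra_simps)
  qed
  have comb: "scott_continuous_on (?P \<times> ?P) (prod_le (\<le>) (\<le>)) ?P (\<le>)
      (\<lambda>(p, q) x. r * p x + (1 - r) * q x)" if r: "r \<in> {0..1}" for r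
    unfolding scott_continuous_on_def
  proof (intro conjI allI impI; (elim conjE)?)
    show "(\<lambda>(p, q) x. r * p x + (1 - r) * q x) \<in> ?P \<times> ?P \<rightarrow> ?P"
      using subprobs_comb[OF r] by auto
    fix S and s :: "('a \<Rightarrow> real) \<times> ('a \<Rightarrow> real)"
    assume S: "directed_in (?P \<times> ?P) (prod_le (\<le>) (\<le>)) S"
      and s: "is_lub_in (?P \<times> ?P) (prod_le (\<le>) (\<le>)) S s"
    note dir = directed_in_fst_snd[OF S]
    have SP: "S \<subseteq> ?P \<times> ?P" using S by (simp add: directed_in_def)
    note lub = is_lub_in_fst_snd[OF SP s]
    obtain u v where [simp]: "s = (u, v)" by (cases s)
    show "is_lub_in ?P (\<le>) ((\<lambda>(p, q) x. r * p x + (1 - r) * q x) ` S)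
        ((\<lambda>(p, q) x. r * p x + (1 - r) * q x) s)"
    proof (rule is_lub_in_funI)
      show "(\<lambda>(p, q) x. r * p x + (1 - r) * q x) s \<in> ?P"
        using s subprobs_comb[OF r] by (auto simp: is_lub_in_def)
      show "a \<le> (\<lambda>(p, q) x. r * p x + (1 - r) * q x) s"
        if aS: "a \<in> (\<lambda>(p, q) x. r * p x + (1 - r) * q x) ` S" for a
      proof -
        obtain p q where "(p, q) \<in> S" and a: "a = (\<lambda>x. r * p x + (1 - r) * q x)"
          using aS by auto
        then have "p \<le> u" "q \<le> v" using s by (auto simp: is_lub_in_def prod_le_def)
        then show ?thesis using r by (auto simp: a le_fun_def intro!: add_mono mult_left_mono)
      qed
      fix x and e :: real assume e: "e > 0"
      obtain p where p: "p \<in> S" "u x - e < fst p x"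
        using subprobs_lubD[OF dir(1) lub(1) e, of x] by auto
      obtain q where q: "q \<in> S" "v x - e < snd q x"
        using subprobs_lubD[OF dir(2) lub(2) e, of x] by auto
      obtain c where c: "c \<in> S" "prod_le (\<le>) (\<le>) p c" "prod_le (\<le>) (\<le>) q c"
        using S p(1) q(1) unfolding directed_in_def by blast
      then have uc: "u x - e < fst c x" and vc: "v x - e < snd c x"
        using p(2) q(2) by (auto simp: prod_le_def le_fun_def intro: less_le_trans)
      \<comment> \<open>The weights add up to 1, so an error \<open>e\<close> in each component
        costs \<open>e\<close> in total and need not be halved.\<close>
      have "r * u x + (1 - r) * v x - e = r * (u x - e) + (1 - r) * (v x - e)"
        by (simp add: algebra_simps)
      also have "\<dots> < r * fst c x + (1 - r) * snd c x"
      \<comment> \<open>Strictness comes from the first summand if \<open>r > 0\<close> and from the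
        second one otherwise.\<close>
      proof (cases "r = 0")
        case False
        then show ?thesis using r uc vc
          by (intro add_less_le_mono mult_left_mono) auto
      qed (use vc in auto)
      finally show "\<exists>a\<in>(\<lambda>(p, q) x. r * p x + (1 - r) * q x) ` S.
          (case s of (p, q) \<Rightarrow> \<lambda>x. r * p x + (1 - r) * q x) x - e < a x"
        using c(1) by (intro bexI[of _ "(\<lambda>(p, q) x. r * p x + (1 - r) * q x) c"]) (auto simp: case_prod_beta)
    qed
  qed
  have scale_mem: "(\<lambda>x. r * p x) \<in> ?P" if "r \<in> {0..1}" "p \<in> ?P" for r p
    using subprobs_comb[OF that zero_in_subprobs] by simp
  have scale: "scott_continuous_on ({0..1} \<times> ?P) (prod_le (\<le>) (\<le>)) ?P (\<le>) (\<lambda>(r, p) x. r * p x)"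
    unfolding scott_continuous_on_def
  proof (intro conjI allI impI; (elim conjE)?)
    show "(\<lambda>(r, p) x. r * p x) \<in> {0..1} \<times> ?P \<rightarrow> ?P" using scale_mem by auto
    fix S and s :: "real \<times> ('a \<Rightarrow> real)"
    assume S: "directed_in ({0..1} \<times> ?P) (prod_le (\<le>) (\<le>)) S"
      and s: "is_lub_in ({0..1} \<times> ?P) (prod_le (\<le>) (\<le>)) S s"
    note dir = directed_in_fst_snd[OF S]
    have SP: "S \<subseteq> {0..1} \<times> ?P" using S by (simp add: directed_in_def)
    note lub = is_lub_in_fst_snd[OF SP s]
    obtain u v where [simp]: "s = (u, v)" by (cases s)
    have uv: "u \<in> {0..1}" "v \<in> ?P" using s by (auto simp: is_lub_in_def)
    show "is_lub_in ?P (\<le>) ((\<lambda>(r, p) x. r * p x) ` S) ((\<lambda>(r, p) x. r * p x) s)"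
    proof (rule is_lub_in_funI)
      show "(\<lambda>(r, p) x. r * p x) s \<in> ?P" using scale_mem uv by auto
      show "a \<le> (\<lambda>(r, p) x. r * p x) s" if aS: "a \<in> (\<lambda>(r, p) x. r * p x) ` S" for a
      proof -
        obtain r p where rp: "(r, p) \<in> S" and a: "a = (\<lambda>x. r * p x)" using aS by auto
        then have "r \<le> u" "p \<le> v" using s by (auto simp: is_lub_in_def prod_le_def)
        moreover have "p \<in> ?P" using rp SP by auto
        ultimately show ?thesis
          using uv subprobsD(1)[of p X] by (auto simp: a le_fun_def intro!: mult_mono)
      qed
      fix x and e :: real assume e: "e > 0"
      then have e2: "e / 2 > 0" by simp
      obtain p where p: "p \<in> S" "u - e / 2 < fst p"
        using is_lub_in_unit_intervalD[OF dir(1) lub(1) e2] by auto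
      obtain q where q: "q \<in> S" "v x - e / 2 < snd q x"
        using subprobs_lubD[OF dir(2) lub(2) e2, of x] by auto
      obtain c where c: "c \<in> S" "prod_le (\<le>) (\<le>) p c" "prod_le (\<le>) (\<le>) q c"
        using S p(1) q(1) unfolding directed_in_def by blast
      obtain r w where [simp]: "c = (r, w)" by (cases c)
      have rw: "r \<in> {0..1}" "w \<in> ?P" using c SP by auto
      have uc: "u - e / 2 < r" and vc: "v x - e / 2 < w x"
        using p(2) q(2) c by (auto simp: prod_le_def le_fun_def intro: less_le_trans)
      \<comment> \<open>The usual splitting for a product: each error is below or at
        \<open>e / 2\<close> and is multiplied by a factor, \<open>u\<close> or \<open>w x\<close>,
        between 0 and 1.\<close>
      have "u * v x - r * w x = u * (v x - w x) + (u - r) * w x" by (simp add: algebra_simps)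
      also have "\<dots> < e / 2 + e / 2"
      proof -
        have w: "0 \<le> w x" "w x \<le> 1" using subprobsD[OF rw(2)] by auto
        have "u * (v x - w x) \<le> u * (e / 2)" using uv vc by (intro mult_left_mono) auto
        also have "\<dots> \<le> e / 2" using uv e by (simp add: mult_left_le_one_le)
        finally have 1: "u * (v x - w x) \<le> e / 2" .
        have 2: "(u - r) * w x < e / 2"
        proof (cases "u - r \<le> 0")
          case True
          then have "(u - r) * w x \<le> 0" using w by (simp add: mult_nonpos_nonneg)
          then show ?thesis using e by simp
        next
          case False
          then have "(u - r) * w x \<le> u - r" using w by (simp add: mult_left_le)
          then show ?thesis using uc by simp
        qed
        from 1 2 show ?thesis by simp
      qed
      finally show "\<exists>a\<in>(\<lambda>(r, p) x. r * p x) ` S. (case s of (r, p) \<Rightarrow> \<lambda>x. r * p x) x - e < a x"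
        using c(1) by (intro bexI[of _ "(\<lambda>(r, p) x. r * p x) c"]) auto
    qed
  qed
  show ?thesis
    unfolding kegelspitze_def subprob_kegel_def kegel.simps
    using dcpo_on_subprobs zero_in_subprobs comb scale assoc
    by (auto simp: algebra_simps)
qed

section \<open>Continuity of the dcpo of weights\<close>

lemma restrict_scale_way_below:
  assumes p: "p \<in> subprobs X" and F: "finite F" and t: "0 \<le> t" "t < 1"
  shows "way_below (subprobs X) (\<le>) (\<lambda>x. if x \<in> F then t * p x else 0) p"
  unfolding way_below_def
proof (intro allI impI; elim conjE)
  fix S s assume S: "directed_in (subprobs X) (\<le>) S" and s: "is_lub_in (subprobs X) (\<le>) S s"
    and ps: "p \<le> s"
  obtain a0 where a0: "a0 \<in> S" using S by (auto simp: directed_in_def)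
  \<comment> \<open>Only where \<open>p\<close> is nonzero does \<open>t < 1\<close> give the strict
    inequality \<open>t * p x < s x\<close> that a member of \<open>S\<close> can realise. At the
    other points the truncated function is 0 and nonnegativity suffices.\<close>
  let ?F = "{x \<in> F. p x \<noteq> 0}"
  have "\<exists>a\<in>S. t * p x < a x" if "x \<in> ?F" for x
  proof -
    have "p x > 0" using that subprobsD(1)[OF p, of x] by auto
    then have "t * p x < p x" using t by simp
    then have "s x - t * p x > 0" using le_funD[OF ps, of x] by linarith
    from subprobs_lubD[OF S s this, of x] show ?thesis by simp
  qed
  then obtain a where a: "a \<in> S" "\<forall>x\<in>?F. t * p x < a x"
    using directed_finite_approx[OF S, of ?F "\<lambda>x. t * p x" a0] F a0 by auto
  moreover have "0 \<le> a x" for x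
    by (rule subprobsD(1)[of a X]) (use a S in \<open>auto simp: directed_in_def\<close>)
  ultimately show "\<exists>d\<in>S. (\<lambda>x. if x \<in> F then t * p x else 0) \<le> d"
    by (intro bexI[of _ a]) (force simp: le_fun_def)+
qed

lemma continuous_dcpo_on_subprobs: "continuous_dcpo_on (subprobs X) (\<le>)"
  unfolding continuous_dcpo_on_def
proof (intro conjI ballI dcpo_on_subprobs)
  fix p assume p: "p \<in> subprobs X"
  let ?W = "{q \<in> subprobs X. way_below (subprobs X) (\<le>) q p}"
  define b where "b F t = (\<lambda>x. if x \<in> F then t * p x else 0)" for F t
  have pos: "0 \<le> p x" for x using subprobsD(1)[OF p] .
  have bW: "b F t \<in> ?W" if "finite F" "0 \<le> t" "t < 1" for F t
  proof -
    have "b F t \<in> subprobs X"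
      by (rule subprobs_down[OF p])
        (use that pos in \<open>auto simp: b_def le_fun_def intro: mult_left_le_one_le\<close>)
    then show ?thesis using restrict_scale_way_below[OF p that] by (simp add: b_def)
  qed
  let ?B = "{b F t | F t. finite F \<and> 0 \<le> t \<and> t < 1}"
  have Bne: "b {} 0 \<in> ?B" by (rule CollectI, intro exI[of _ "{}"] exI[of _ 0]) simp
  have join: "\<exists>c\<in>?B. q \<le> c \<and> r \<le> c" if "q \<in> ?B" "r \<in> ?B" for q r
  proof -
    obtain F t G u where "q = b F t" "r = b G u" "finite F" "0 \<le> t" "t < 1"
      "finite G" "0 \<le> u" "u < 1" using \<open>q \<in> ?B\<close> \<open>r \<in> ?B\<close> by blast
    then show ?thesis using pos
      by (intro bexI[of _ "b (F \<union> G) (max t u)"] CollectI exI[of _ "F \<union> G"] exI[of _ "max t u"])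
        (auto simp: b_def le_fun_def intro: mult_right_mono)
  qed
  have B: "directed_in (subprobs X) (\<le>) ?B"
    unfolding directed_in_def using bW Bne join by blast
  have app: "\<exists>q\<in>?B. p x - e < q x" if e: "e > 0" for x e
  proof -
    \<comment> \<open>As \<open>p x \<le> 1\<close>, scaling by \<open>t\<close> loses at most
      \<open>1 - t \<le> e / 2\<close>; the maximum keeps \<open>t\<close> nonnegative for large
      \<open>e\<close>.\<close>
    define t where "t = max 0 (1 - e / 2)"
    have "p x \<le> 1" using subprobsD(4)[OF p] .
    moreover have "1 - t \<le> e / 2" "1 - t \<ge> 0" using e by (auto simp: t_def max_def)
    ultimately have "p x * (1 - t) \<le> 1 * (e / 2)"
      using pos[of x] by (intro mult_mono) auto
    then have "p x - e < b {x} t x"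
      using e by (simp add: b_def algebra_simps)
    moreover have "b {x} t \<in> ?B" using e by (intro CollectI exI[of _ "{x}"] exI[of _ t]) (auto simp: t_def)
    ultimately show ?thesis by blast
  qed
  have lub: "is_lub_in (subprobs X) (\<le>) ?B p"
    by (rule is_lub_in_funI[OF p _ app])
      (use pos in \<open>auto simp: b_def le_fun_def intro!: mult_left_le_one_le\<close>)
  \<comment> \<open>Since \<open>?B\<close> is directed with supremum \<open>p\<close>, the
    definition of way-below can be applied to \<open>?B\<close> itself. This makes \<open>?B\<close>
    cofinal in \<open>?W\<close>, which then inherits directedness and supremum from it.\<close>
  have WB: "\<exists>c\<in>?B. q \<le> c" if "q \<in> ?W" for q
    using that B lub unfolding way_below_def by blast
  have "b {} 0 \<in> ?W" by (rule bW) auto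
  moreover have "\<exists>c\<in>?W. q \<le> c \<and> r \<le> c" if qr: "q \<in> ?W" "r \<in> ?W" for q r
  proof -
    obtain c d where cd: "c \<in> ?B" "d \<in> ?B" "q \<le> c" "r \<le> d" using WB qr by meson
    obtain f where "f \<in> ?B" "c \<le> f" "d \<le> f" using join[OF cd(1,2)] by blast
    then show ?thesis using cd bW by (blast intro: order_trans)
  qed
  ultimately show "directed_in (subprobs X) (\<le>) ?W"
    unfolding directed_in_def by blast
  show "is_lub_in (subprobs X) (\<le>) ?W p"
  proof (rule is_lub_in_funI[OF p])
    show "q \<le> p" if q: "q \<in> ?W" for q
    proof -
      obtain c where "c \<in> ?B" "q \<le> c" using WB[OF q] by blast
      then show ?thesis using lub unfolding is_lub_in_def by (meson order_trans)
    qed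
    show "\<exists>q\<in>?W. p x - e < q x" if "e > 0" for x e
      using app[OF that] bW by blast
  qed
qed

lemma continuous_kegelspitze_subprob: "continuous_kegelspitze (subprob_kegel X)"
  unfolding continuous_kegelspitze_def
  using kegelspitze_subprob continuous_dcpo_on_subprobs by (auto simp: subprob_kegel_def)

subsection \<open>Valuations on a discrete order\<close>

text \<open>For equality as order, an upper bound equals every element below it, so a supremum
  already belongs to its directed set.\<close>

lemma scott_opens_discrete: "scott_opens X (=) = Pow X"
proof -
  have "S \<inter> U \<noteq> {}" if S: "directed_in X (=) S" "is_lub_in X (=) S s" "s \<in> U" for S s U
  proof -
    obtain a where "a \<in> S" using S(1) by (auto simp: directed_in_def)
    moreover have "a = s" using \<open>a \<in> S\<close> S(2) by (auto simp: is_lub_in_def)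
    ultimately show ?thesis using S(3) by blast
  qed
  then show ?thesis by (auto simp: scott_opens_def)
qed

lemma summable_on_subprobs: "p \<in> subprobs X \<Longrightarrow> p summable_on A"
  by (rule nonneg_bounded_partial_sums_imp_summable_on[where C=1])
    (auto simp: subprobsD eventually_finite_subsets_at_top intro!: exI[of _ "{}"])

definition discrete_valuation :: "'a set \<Rightarrow> ('a \<Rightarrow> real) \<Rightarrow> 'a set \<Rightarrow> real" where
  "discrete_valuation X p U = (if U \<subseteq> X then infsum p U else 0)"

text \<open>A sum of nonnegative terms is the supremum of its finite partial sums. The bound by 1,
  monotonicity and Scott continuity of the valuation all reduce to this equivalence.\<close>

lemma discrete_valuation_le_iff:
  assumes p: "p \<in> subprobs X" and U: "U \<subseteq> X"
  shows "discrete_valuation X p U \<le> u \<longleftrightarrow> (\<forall>F. finite F \<and> F \<subseteq> U \<longrightarrow> sum p F \<le> u)"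
proof -
  have "sum p F \<le> infsum p U" if "finite F" "F \<subseteq> U" for F
    using finite_sum_le_infsum[OF summable_on_subprobs[OF p] that] subprobsD(1)[OF p] by auto
  then show ?thesis
    using U infsum_le_finite_sums[OF summable_on_subprobs[OF p], of U u]
    by (auto simp: discrete_valuation_def intro: order_trans)
qed

lemma discrete_valuation_singleton:
  "p \<in> subprobs X \<Longrightarrow> discrete_valuation X p {x} = p x"
  by (auto simp: discrete_valuation_def subprobsD)

lemma discrete_valuation_finite:
  "finite F \<Longrightarrow> F \<subseteq> X \<Longrightarrow> discrete_valuation X p F = sum p F"
  by (simp add: discrete_valuation_def)

lemma is_lub_in_Pow_Union:
  assumes "S \<subseteq> Pow X"
  shows "is_lub_in (Pow X) (\<subseteq>) S s \<longleftrightarrow> s = \<Union>S"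
proof
  assume s: "is_lub_in (Pow X) (\<subseteq>) S s"
  have "\<Union>S \<in> Pow X" "\<forall>a\<in>S. a \<subseteq> \<Union>S" using assms by auto
  then have "s \<subseteq> \<Union>S" using s unfolding is_lub_in_def by blast
  moreover have "\<Union>S \<subseteq> s" using s by (intro Union_least) (simp add: is_lub_in_def)
  ultimately show "s = \<Union>S" by (rule equalityI)
next
  assume "s = \<Union>S"
  then show "is_lub_in (Pow X) (\<subseteq>) S s"
    using assms by (auto simp: is_lub_in_def)
qed

text \<open>This is compactness of finite sets in the lattice of subsets.\<close>

lemma directed_Union_finite_subset:
  assumes S: "directed_in D (\<subseteq>) S" and "finite F" "F \<subseteq> \<Union>S"
  shows "\<exists>V\<in>S. F \<subseteq> V"
  using assms(2,3)
proof (induction F)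
  case empty
  then show ?case using S by (auto simp: directed_in_def)
next
  case (insert x F)
  then obtain V W where "V \<in> S" "F \<subseteq> V" "W \<in> S" "x \<in> W" by auto
  moreover obtain Z where "Z \<in> S" "V \<subseteq> Z" "W \<subseteq> Z"
    using S \<open>V \<in> S\<close> \<open>W \<in> S\<close> unfolding directed_in_def by blast
  ultimately show ?case by (intro bexI[of _ Z]) auto
qed

lemma discrete_valuation_in_valuations:
  assumes p: "p \<in> subprobs X"
  shows "discrete_valuation X p \<in> valuations X (=)"
  unfolding valuations_def scott_opens_discrete
proof (intro CollectI conjI allI impI ballI)
  let ?\<nu> = "discrete_valuation X p"
  show "?\<nu> U = 0" if "U \<notin> Pow X" for U using that by (simp add: discrete_valuation_def)
  show "?\<nu> {} = 0" by (simp add: discrete_valuation_def)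
  show "?\<nu> U + ?\<nu> V = ?\<nu> (U \<union> V) + ?\<nu> (U \<inter> V)" if "U \<in> Pow X" "V \<in> Pow X" for U V
    using that infsum_Un_Int[of p U V] summable_on_subprobs[OF p]
    by (auto simp: discrete_valuation_def)
  have mem: "?\<nu> U \<in> {0..1}" if "U \<in> Pow X" for U
    using that discrete_valuation_le_iff[OF p, of U 1] subprobsD[OF p]
    by (auto simp: discrete_valuation_def intro!: infsum_nonneg)
  show "scott_continuous_on (Pow X) (\<subseteq>) {0..1} (\<le>) ?\<nu>"
    unfolding scott_continuous_on_def
  proof (intro conjI allI impI; (elim conjE)?)
    show "?\<nu> \<in> Pow X \<rightarrow> {0..1}" using mem by blast
    fix S U assume S: "directed_in (Pow X) (\<subseteq>) S" and "is_lub_in (Pow X) (\<subseteq>) S U"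
    then have U: "U = \<Union>S" and SX: "S \<subseteq> Pow X"
      by (auto simp: directed_in_def is_lub_in_Pow_Union)
    then have UX: "U \<subseteq> X" by auto
    have mono: "?\<nu> V \<le> ?\<nu> W" if VW: "V \<subseteq> W" "W \<subseteq> X" for V W
    proof -
      have "V \<subseteq> X" using VW by auto
      then show ?thesis
        using discrete_valuation_le_iff[OF p, of V "?\<nu> W"]
          discrete_valuation_le_iff[OF p, of W "?\<nu> W"] VW by auto
    qed
    have "?\<nu> U \<le> u" if u: "\<forall>a\<in>?\<nu> ` S. a \<le> u" for u
      unfolding discrete_valuation_le_iff[OF p UX]
    proof (intro allI impI; elim conjE)
      fix F assume F: "finite F" "F \<subseteq> U"
      then obtain V where V: "V \<in> S" "F \<subseteq> V" using directed_Union_finite_subset[OF S] U by blast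
      then have "?\<nu> V \<le> u" "V \<subseteq> X" using u SX by auto
      then show "sum p F \<le> u" using discrete_valuation_le_iff[OF p, of V u] F V by blast
    qed
    moreover have "a \<le> ?\<nu> U" if "a \<in> ?\<nu> ` S" for a
      using that U UX by (auto intro!: mono)
    moreover have "?\<nu> U \<in> {0..1}" using mem UX by simp
    ultimately show "is_lub_in {0..1} (\<le>) (?\<nu> ` S) (?\<nu> U)"
      unfolding is_lub_in_def by (intro conjI ballI impI)
  qed
qed

text \<open>Modularity together with \<open>\<nu> {} = 0\<close> gives additivity on finite sets.
  Any \<open>U\<close> is the directed union of its finite subsets, so two valuations that agree on
  finite sets have values at \<open>U\<close> that are suprema of the same set of reals.\<close>

lemma valuation_eq_discrete_valuation:
  assumes \<nu>: "\<nu> \<in> valuations X (=)"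
  defines "p \<equiv> \<lambda>x. \<nu> {x}"
  shows "p \<in> subprobs X" "\<nu> = discrete_valuation X p"
proof -
  have off: "\<nu> U = 0" if "\<not> U \<subseteq> X" for U
    using \<nu> that by (simp add: valuations_def scott_opens_discrete)
  have sc: "scott_continuous_on (Pow X) (\<subseteq>) {0..1} (\<le>) \<nu>"
    and emp: "\<nu> {} = 0"
    and modular: "\<And>U V. U \<subseteq> X \<Longrightarrow> V \<subseteq> X \<Longrightarrow> \<nu> U + \<nu> V = \<nu> (U \<union> V) + \<nu> (U \<inter> V)"
    using \<nu> by (auto simp: valuations_def scott_opens_discrete)
  have mem: "0 \<le> \<nu> U" "\<nu> U \<le> 1" if "U \<subseteq> X" for U
    using sc that by (auto simp: scott_continuous_on_def Pi_iff)
  have fin: "\<nu> F = sum p F" if "finite F" "F \<subseteq> X" for F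
    using that
  proof (induction F)
    case (insert x F)
    then have "\<nu> {x} + \<nu> F = \<nu> (insert x F) + \<nu> {}"
      using modular[of "{x}" F] by (simp add: Int_insert_left)
    then show ?case using insert by (simp add: p_def emp)
  qed (simp add: emp)
  have p0: "0 \<le> p x" for x using mem(1)[of "{x}"] off[of "{x}"] by (cases "x \<in> X") (auto simp: p_def)
  have pX: "p x = 0" if "x \<notin> X" for x using off[of "{x}"] that by (simp add: p_def)
  have "sum p F \<le> 1" if "finite F" for F
  proof -
    have "sum p F = sum p (F \<inter> X)"
      by (rule sum.mono_neutral_right) (use that pX in auto)
    then show ?thesis using fin[of "F \<inter> X"] mem(2)[of "F \<inter> X"] that by simp
  qed
  then show p: "p \<in> subprobs X" using p0 pX by (simp add: subprobs_def)
  show "\<nu> = discrete_valuation X p"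
  proof
    fix U
    show "\<nu> U = discrete_valuation X p U"
    proof (cases "U \<subseteq> X")
      case True
      let ?S = "{F. finite F \<and> F \<subseteq> U}"
      have SX: "?S \<subseteq> Pow X" using True by auto
      have "\<exists>c\<in>?S. F \<subseteq> c \<and> G \<subseteq> c" if "F \<in> ?S" "G \<in> ?S" for F G
        using that by (intro bexI[of _ "F \<union> G"]) auto
      then have S: "directed_in (Pow X) (\<subseteq>) ?S"
        unfolding directed_in_def using SX by blast
      have "U = \<Union>?S" by blast
      then have lub: "is_lub_in (Pow X) (\<subseteq>) ?S U" using is_lub_in_Pow_Union[OF SX] by blast
      have *: "is_lub_in {0..1} (\<le>) (\<mu> ` ?S) (\<mu> U)" if "\<mu> \<in> valuations X (=)" for \<mu>
        using that S lub by (auto simp: valuations_def scott_opens_discrete scott_continuous_on_def)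
      have "\<nu> ` ?S = discrete_valuation X p ` ?S"
        using True by (intro image_cong) (auto simp: fin discrete_valuation_finite)
      then show ?thesis
        using *[OF \<nu>] *[OF discrete_valuation_in_valuations[OF p]]
        unfolding is_lub_in_def by (metis order_antisym)
    qed (simp add: off discrete_valuation_def)
  qed
qed

lemma dirac_eq_discrete_valuation:
  assumes "x \<in> X"
  shows "dirac X (=) x = discrete_valuation X (\<lambda>y. if y = x then 1 else 0)"
proof
  fix U
  have "infsum (\<lambda>y. if y = x then 1 else 0) U = (infsum (\<lambda>y. if y = x then 1 else 0) (U \<inter> {x}) :: real)"
    by (rule infsum_cong_neutral) auto
  then show "dirac X (=) x U = discrete_valuation X (\<lambda>y. if y = x then 1 else 0) U"
    by (cases "x \<in> U") (auto simp: dirac_def discrete_valuation_def scott_opens_discrete)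
qed

lemma order_iso_on_discrete_valuation:
  "order_iso_on (subprobs X) (\<le>) (valuations X (=)) (stochastic_le X (=)) (discrete_valuation X)"
  unfolding order_iso_on_def
proof (intro conjI ballI)
  show "bij_betw (discrete_valuation X) (subprobs X) (valuations X (=))"
    unfolding bij_betw_def
  proof
    show "inj_on (discrete_valuation X) (subprobs X)"
      by (rule inj_onI, rule ext) (metis discrete_valuation_singleton)
    show "discrete_valuation X ` subprobs X = valuations X (=)"
      using discrete_valuation_in_valuations valuation_eq_discrete_valuation by blast
  qed
  fix p q assume p: "p \<in> subprobs X" and q: "q \<in> subprobs X"
  show "p \<le> q \<longleftrightarrow> stochastic_le X (=) (discrete_valuation X p) (discrete_valuation X q)"
  proof
    assume "p \<le> q"
    then have "infsum p U \<le> infsum q U" for U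
      by (intro infsum_mono summable_on_subprobs[OF p] summable_on_subprobs[OF q]) (simp add: le_fun_def)
    then show "stochastic_le X (=) (discrete_valuation X p) (discrete_valuation X q)"
      by (simp add: stochastic_le_def scott_opens_discrete discrete_valuation_def)
  next
    assume st: "stochastic_le X (=) (discrete_valuation X p) (discrete_valuation X q)"
    have "p x \<le> q x" for x
    proof (cases "x \<in> X")
      case True
      then have "discrete_valuation X p {x} \<le> discrete_valuation X q {x}"
        using st by (simp add: stochastic_le_def scott_opens_discrete)
      then show ?thesis by (simp add: discrete_valuation_singleton p q)
    qed (simp add: subprobsD(2)[OF p] subprobsD(2)[OF q])
    then show "p \<le> q" by (simp add: le_fun_def)
  qed
qed

section \<open>Simple and minimal valuations\<close>

lemma has_sum_sum_infsum:
  fixes f :: "'i \<Rightarrow> 'a \<Rightarrow> 'b::{topological_comm_monoid_add,t2_space}"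
  assumes "finite I" "\<And>i. i \<in> I \<Longrightarrow> f i summable_on A"
  shows "((\<lambda>x. \<Sum>i\<in>I. f i x) has_sum (\<Sum>i\<in>I. infsum (f i) A)) A"
  using assms by (induction I) (auto intro!: has_sum_add has_sum_infsum has_sum_0)

text \<open>The points \<open>x i\<close> may repeat, so the weight at \<open>y\<close> collects
  every index with \<open>x i = y\<close>. Exchanging the two sums bounds partial sums of this
  weight by the total mass of the \<open>r i\<close>.\<close>

lemma sum_dirac_in_subprobs:
  fixes n :: nat
  assumes "\<forall>i<n. x i \<in> X \<and> 0 \<le> r i" "(\<Sum>i<n. r i) \<le> 1"
  shows "(\<lambda>y. \<Sum>i<n. r i * (if y = x i then 1 else 0)) \<in> subprobs X"
    and "(\<lambda>U. \<Sum>i<n. r i * dirac X (=) (x i) U) =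
      discrete_valuation X (\<lambda>y. \<Sum>i<n. r i * (if y = x i then 1 else 0))"
proof -
  let ?p = "\<lambda>y. \<Sum>i<n. r i * (if y = x i then 1 else 0)"
  let ?\<nu> = "\<lambda>U. \<Sum>i<n. r i * dirac X (=) (x i) U"
  have "sum ?p F \<le> 1" if "finite F" for F
  proof -
    have "sum ?p F = (\<Sum>i<n. \<Sum>y\<in>F. r i * (if y = x i then 1 else 0))" by (rule sum.swap)
    also have "\<dots> \<le> (\<Sum>i<n. r i)"
      using assms(1) that
      by (intro sum_mono) (auto simp: sum.delta' if_distrib cong: if_cong)
    finally show ?thesis using assms(2) by simp
  qed
  then show p: "?p \<in> subprobs X"
    using assms(1) by (auto simp: subprobs_def intro!: sum_nonneg sum.neutral)
  show "?\<nu> = discrete_valuation X ?p"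
  proof
    fix U
    show "?\<nu> U = discrete_valuation X ?p U"
    proof (cases "U \<subseteq> X")
      case True
      have "infsum ?p U = (\<Sum>i<n. infsum (\<lambda>y. r i * (if y = x i then 1 else 0)) U)"
        by (intro infsumI has_sum_sum_infsum) (auto intro: summable_on_cmult_right
          finite_nonzero_values_imp_summable_on)
      also have "\<dots> = ?\<nu> U"
        using True assms(1) dirac_eq_discrete_valuation[of _ X]
        by (intro sum.cong) (auto simp: infsum_cmult_right' discrete_valuation_def)
      finally show ?thesis using True by (simp add: discrete_valuation_def)
    qed (simp add: dirac_def discrete_valuation_def scott_opens_discrete)
  qed
qed

lemma minimal_valuations_discrete: "minimal_valuations X (=) = valuations X (=)"
proof
  have "simple_valuations X (=) \<subseteq> valuations X (=)"
  proof
    fix \<nu> assume "\<nu> \<in> simple_valuations X (=)"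
    then obtain n :: nat and r x where a: "\<forall>i<n. x i \<in> X \<and> 0 \<le> r i" "(\<Sum>i<n. r i) \<le> 1"
      and \<nu>: "\<nu> = (\<lambda>U. \<Sum>i<n. r i * dirac X (=) (x i) U)"
      unfolding simple_valuations_def by blast
    show "\<nu> \<in> valuations X (=)"
      unfolding \<nu> sum_dirac_in_subprobs(2)[OF a]
      by (intro discrete_valuation_in_valuations sum_dirac_in_subprobs(1)[OF a])
  qed
  then show "minimal_valuations X (=) \<subseteq> valuations X (=)"
    unfolding minimal_valuations_def by (intro Inter_lower) (auto simp: is_lub_in_def)
next
  show "valuations X (=) \<subseteq> minimal_valuations X (=)"
    unfolding minimal_valuations_def
  proof (intro subsetI InterI; elim CollectE conjE)
    fix \<nu> W assume \<nu>: "\<nu> \<in> valuations X (=)" and simple: "simple_valuations X (=) \<subseteq> W"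
      and cl: "\<forall>S s. S \<subseteq> W \<and> directed_in (valuations X (=)) (stochastic_le X (=)) S \<and>
            is_lub_in (valuations X (=)) (stochastic_le X (=)) S s \<longrightarrow> s \<in> W"
    obtain p where p: "p \<in> subprobs X" and \<nu>p: "\<nu> = discrete_valuation X p"
      using valuation_eq_discrete_valuation[OF \<nu>] by blast
    \<comment> \<open>No scaling factor here: only the supremum of the truncations matters, not the
      way-below relation.\<close>
    define b where "b F = (\<lambda>x. if x \<in> F then p x else 0)" for F
    let ?B = "b ` {F. finite F}"
    have pos: "0 \<le> p x" for x using subprobsD(1)[OF p] .
    have bP: "b F \<in> subprobs X" for F
      by (rule subprobs_down[OF p]) (use pos in \<open>auto simp: b_def le_fun_def\<close>)
    have "\<exists>c\<in>?B. a \<le> c \<and> a' \<le> c" if aa: "a \<in> ?B" "a' \<in> ?B" for a a'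
    proof -
      obtain F G where "a = b F" "a' = b G" "finite F" "finite G" using aa by auto
      moreover from this have "b (F \<union> G) \<in> ?B" by blast
      ultimately show ?thesis
        using pos by (intro bexI[of _ "b (F \<union> G)"]) (auto simp: b_def le_fun_def)
    qed
    then have B: "directed_in (subprobs X) (\<le>) ?B"
      unfolding directed_in_def using bP by blast
    have lub: "is_lub_in (subprobs X) (\<le>) ?B p"
    proof (rule is_lub_in_funI[OF p])
      show "a \<le> p" if "a \<in> ?B" for a using that pos by (auto simp: b_def le_fun_def)
      show "\<exists>a\<in>?B. p x - e < a x" if "e > 0" for x e
      proof
        show "b {x} \<in> ?B" by blast
        show "p x - e < b {x} x" using that by (simp add: b_def)
      qed
    qed
    have BP: "?B \<subseteq> subprobs X" using bP by blast
    note o = order_iso_on_discrete_valuation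
    have "discrete_valuation X ` ?B \<subseteq> W"
    proof (intro image_subsetI subsetD[OF simple])
      fix q assume "q \<in> ?B"
      \<comment> \<open>Simple valuations may charge points of \<open>X\<close> only, hence the
        intersection; nothing is lost because \<open>p\<close> vanishes elsewhere.\<close>
      then obtain F where q: "q = b F" and F: "finite (F \<inter> X)" by auto
      obtain h where h: "bij_betw h {..<card (F \<inter> X)} (F \<inter> X)"
        using ex_bij_betw_nat_finite[OF F] by (auto simp: atLeast0LessThan)
      let ?n = "card (F \<inter> X)"
      have reindex: "(\<Sum>i<?n. f (h i)) = sum f (F \<inter> X)" for f :: "'a \<Rightarrow> real"
        using sum.reindex_bij_betw[OF h] .
      have hX: "\<forall>i<?n. h i \<in> X \<and> 0 \<le> p (h i)" using h pos by (auto simp: bij_betw_def)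
      have le1: "(\<Sum>i<?n. p (h i)) \<le> 1" using reindex[of p] subprobsD(3)[OF p F] by simp
      have "b F = (\<lambda>y. \<Sum>i<?n. p (h i) * (if y = h i then 1 else 0))"
      proof
        fix y
        have "(\<Sum>i<?n. p (h i) * (if y = h i then 1 else 0)) = (\<Sum>z\<in>F \<inter> X. p z * (if y = z then 1 else 0))"
          by (rule reindex)
        also have "\<dots> = b F y"
          using F subprobsD(2)[OF p, of y]
          by (auto simp: b_def if_distrib sum.delta cong: if_cong)
        finally show "b F y = (\<Sum>i<?n. p (h i) * (if y = h i then 1 else 0))" by simp
      qed
      then have "discrete_valuation X (b F) = (\<lambda>U. \<Sum>i<?n. p (h i) * dirac X (=) (h i) U)"
        using sum_dirac_in_subprobs(2)[OF hX le1] by simp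
      then show "discrete_valuation X q \<in> simple_valuations X (=)"
        unfolding q simple_valuations_def using hX le1
        by (intro CollectI exI[of _ ?n] exI[of _ "\<lambda>i. p (h i)"] exI[of _ h] conjI)
    qed
    then show "\<nu> \<in> W"
      using cl directed_in_image[OF o B] is_lub_in_image[OF o BP lub] unfolding \<nu>p
      by (elim allE[of _ "discrete_valuation X ` ?B"] allE[of _ "discrete_valuation X p"] mp) (intro conjI)
  qed
qed

lemma kegelspitze_iso_discrete_valuation:
  "kegelspitze_iso (subprob_kegel X) (valuation_kegel X (=)) (discrete_valuation X)"
proof -
  have "discrete_valuation X (\<lambda>x. r * p x + (1 - r) * q x) U =
      r * discrete_valuation X p U + (1 - r) * discrete_valuation X q U"
    if "p \<in> subprobs X" "q \<in> subprobs X" for r p q U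
    by (simp add: discrete_valuation_def infsum_add infsum_cmult_right' summable_on_cmult_right
        summable_on_subprobs[OF that(1)] summable_on_subprobs[OF that(2)])
  moreover have "discrete_valuation X (\<lambda>x. 0) = (\<lambda>U. 0)"
    by (simp add: discrete_valuation_def fun_eq_iff)
  ultimately show ?thesis
    using order_iso_on_discrete_valuation[of X]
    by (auto simp: kegelspitze_iso_def subprob_kegel_def valuation_kegel_def order_iso_on_def
        minimal_valuations_discrete)
qed

subsection \<open>Positive semidefinite matrices\<close>

definition quad_form :: "nat \<Rightarrow> (nat \<Rightarrow> nat \<Rightarrow> complex) \<Rightarrow> (nat \<Rightarrow> complex) \<Rightarrow> complex" where
  "quad_form n M c = (\<Sum>i<n. \<Sum>j<n. cnj (c i) * M i j * c j)"

lemma quad_form_single: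
  assumes "i < n"
  shows "quad_form n M (\<lambda>k. if k = i then a else 0) = cnj a * M i i * a"
proof -
  have "quad_form n M (\<lambda>k. if k = i then a else 0) =
      (\<Sum>k\<in>{i}. \<Sum>l\<in>{i}. cnj (if k = i then a else 0) * M k l * (if l = i then a else 0))"
    unfolding quad_form_def using assms
    by (intro sum.mono_neutral_cong_right ballI sum.neutral) auto
  then show ?thesis by simp
qed

lemma quad_form_pair:
  assumes "i < n" "j < n" "i \<noteq> j"
  shows "quad_form n M (\<lambda>k. if k = i then a else if k = j then b else 0) =
    cnj a * M i i * a + cnj a * M i j * b + cnj b * M j i * a + cnj b * M j j * b"
proof -
  let ?c = "\<lambda>k. if k = i then a else if k = j then b else 0"
  have "quad_form n M ?c = (\<Sum>k\<in>{i, j}. \<Sum>l\<in>{i, j}. cnj (?c k) * M k l * ?c l)"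
    unfolding quad_form_def using assms
    by (intro sum.mono_neutral_cong_right ballI sum.neutral) auto
  then show ?thesis using assms(3) by simp
qed

text \<open>Isolates the last coordinate, in which the square will be completed.\<close>

lemma quad_form_Suc:
  "quad_form (Suc n) M (c(n := y)) = quad_form n M c + (\<Sum>i<n. cnj (c i) * M i n) * y
     + cnj y * (\<Sum>j<n. M n j * c j) + cnj y * M n n * y"
  by (simp add: quad_form_def sum.distrib sum_distrib_left sum_distrib_right mult.assoc)

lemma hermitian_if_quad_form_nonneg:
  assumes psd: "\<And>c. quad_form n M c \<in> \<real>\<^sub>\<ge>\<^sub>0" and "i < n" "j < n"
  shows "M j i = cnj (M i j)"
proof -
  have diag: "Im (M k k) = 0" if "k < n" for k
    using psd[of "\<lambda>l. if l = k then 1 else 0"] that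
    by (simp add: quad_form_single complex_nonneg_Reals_iff)
  show ?thesis
  proof (cases "i = j")
    case True
    then show ?thesis using diag[OF assms(2)] by (simp add: complex_eq_iff)
  next
    case False
    note * = psd[of "\<lambda>k. if k = i then a else if k = j then b else 0" for a b,
        unfolded quad_form_pair[OF assms(2,3) False] complex_nonneg_Reals_iff]
    show ?thesis
      \<comment> \<open>Polarisation: with real diagonal entries, a real value at the coefficients
        1, 1 makes the imaginary parts of \<open>M i j\<close> and \<open>M j i\<close> opposite,
        and one at 1, \<open>\<i>\<close> makes their real parts equal.\<close>
      using *[of 1 1] *[of 1 \<i>] diag[OF assms(2)] diag[OF assms(3)]
      by (simp add: complex_eq_iff)
  qed
qed

text \<open>Cholesky factorisation: one step splits off the last row and passes to the Schur complement.
  Since \<open>x / 0 = 0\<close>, the same formulas cover a vanishing last diagonal entry.\<close>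

lemma gram_if_quad_form_nonneg:
  assumes "\<And>c. quad_form n M c \<in> \<real>\<^sub>\<ge>\<^sub>0"
  shows "\<exists>N. \<forall>i<n. \<forall>j<n. M i j = (\<Sum>k<n. cnj (N k i) * N k j)"
  using assms
proof (induction n arbitrary: M)
  case (Suc n)
  note herm = hermitian_if_quad_form_nonneg[OF Suc.prems]
  define \<alpha> where "\<alpha> = Re (M n n)"
  have Mnn: "M n n = of_real \<alpha>" and \<alpha>: "\<alpha> \<ge> 0"
    using Suc.prems[of "\<lambda>l. if l = n then 1 else 0"]
    by (simp_all add: \<alpha>_def quad_form_single complex_nonneg_Reals_iff complex_eq_iff)
  have last: "M i n = 0" if "\<alpha> = 0" "i < n" for i
  proof -
    define m where "m = Re (M i i)"
    let ?z = "M i n"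
    have "0 \<le> Re (cnj ?z * M i i * ?z + cnj ?z * ?z * of_real s + of_real s * cnj ?z * ?z)" for s
      using Suc.prems[of "\<lambda>k. if k = i then ?z else if k = n then of_real s else 0"] that Mnn
        herm[of i n] by (simp add: quad_form_pair complex_nonneg_Reals_iff)
    \<comment> \<open>For \<open>\<alpha> = 0\<close> the form at this test vector is
      \<open>m + 2 * s\<close> times the squared modulus of \<open>?z\<close>. The chosen
      \<open>s\<close> makes the factor -1, which forces \<open>?z = 0\<close>.\<close>
    from this[of "- (m + 1) / 2"]
    have "0 \<le> - ((Re ?z)\<^sup>2 + (Im ?z)\<^sup>2)"
      using herm[of i i] that by (simp add: m_def complex_eq_iff power2_eq_square algebra_simps)
    then have "(Re ?z)\<^sup>2 + (Im ?z)\<^sup>2 = 0" by (smt (verit) zero_le_power2)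
    then show ?thesis by (simp add: complex_eq_iff sum_power2_eq_zero_iff)
  qed
  define M' where "M' i j = M i j - M i n * M n j / of_real \<alpha>" for i j
  have "quad_form n M' c \<in> \<real>\<^sub>\<ge>\<^sub>0" for c
  proof -
    define w where "w = (\<Sum>j<n. M n j * c j)"
    have w': "(\<Sum>i<n. cnj (c i) * M i n) = cnj w"
      unfolding w_def cnj_sum by (intro sum.cong) (auto simp: herm[of n] mult.commute)
    have "quad_form n M' c = quad_form n M c
        - (\<Sum>i<n. \<Sum>j<n. (cnj (c i) * M i n) * (M n j * c j)) / of_real \<alpha>"
      by (simp add: quad_form_def M'_def sum_subtractf sum_divide_distrib algebra_simps)
    also have "(\<Sum>i<n. \<Sum>j<n. (cnj (c i) * M i n) * (M n j * c j)) = cnj w * w"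
      unfolding sum_product[symmetric] w' w_def[symmetric] ..
    \<comment> \<open>Completing the square: for positive \<open>\<alpha>\<close> the value
      \<open>- w / \<alpha>\<close> minimises the form in the last coordinate, and the minimum is
      the form of the Schur complement. For \<open>\<alpha> = 0\<close> both quotients are 0 and the
      two sides agree.\<close>
    also have "quad_form n M c - cnj w * w / of_real \<alpha> = quad_form (Suc n) M (c(n := - w / of_real \<alpha>))"
      unfolding quad_form_Suc w' w_def[symmetric] Mnn
      by (cases "\<alpha> = 0") (simp_all add: field_simps)
    finally show ?thesis using Suc.prems by simp
  qed
  from Suc.IH[OF this] obtain N where N: "\<And>i j. i < n \<Longrightarrow> j < n \<Longrightarrow> M' i j = (\<Sum>k<n. cnj (N k i) * N k j)"
    by blast
  \<comment> \<open>Row \<open>n\<close> is the last row of \<open>M\<close> divided by the square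
    root of the pivot, and the rest of column \<open>n\<close> is 0, so the old rows contribute
    nothing to entries with an index \<open>n\<close>.\<close>
  define N' where "N' k i = (if k = n then M n i / of_real (sqrt \<alpha>) else if i = n then 0 else N k i)" for k i
  have sq: "complex_of_real (sqrt \<alpha>) * of_real (sqrt \<alpha>) = of_real \<alpha>"
    using \<alpha> by (simp flip: of_real_mult)
  have N'n: "cnj (N' n i) * N' n j = M i n * M n j / of_real \<alpha>" if "i < Suc n" for i j
    using herm[of i n] herm[of n i] that by (simp add: N'_def sq)
  have "M i j = (\<Sum>k<Suc n. cnj (N' k i) * N' k j)" if ij: "i < Suc n" "j < Suc n" for i j
  proof (cases "i < n \<and> j < n")
    case True
    then have "(\<Sum>k<n. cnj (N' k i) * N' k j) = M' i j"
      unfolding N[OF conjunct1[OF True] conjunct2[OF True]] by (intro sum.cong) (auto simp: N'_def)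
    then show ?thesis using N'n[OF ij(1), of j] by (simp add: M'_def)
  next
    case False
    then have "(\<Sum>k<n. cnj (N' k i) * N' k j) = 0"
      using ij by (intro sum.neutral) (auto simp: N'_def)
    moreover have "M i j = M i n * M n j / of_real \<alpha>"
    proof (cases "\<alpha> = 0")
      case True
      then have "M i n = 0" "M n j = 0"
        using last[of i] last[of j] herm[of j n] ij Mnn by (auto simp: less_Suc_eq)
      then show ?thesis using False ij by (auto simp: less_Suc_eq)
    next
      case \<alpha>0: False
      then show ?thesis using False ij Mnn by (auto simp: less_Suc_eq)
    qed
    ultimately show ?thesis using N'n[OF ij(1), of j] by simp
  qed
  then show ?case by blast
qed simp

subsection \<open>Functionals on bounded functions\<close>

lemma sum_fun_apply: "(\<Sum>i\<in>I. f i) x = (\<Sum>i\<in>I. f i x)"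
  for f :: "'i \<Rightarrow> 'a \<Rightarrow> 'b::comm_monoid_add"
  by (induction I rule: infinite_finite_induct) auto

lemma star_alg_simps [simp]:
  "scal (linf X) = (\<lambda>c f x. c * f x)" "adj (linf X) = (\<lambda>f x. cnj (f x))" "unt (linf X) = indicator X"
  "elems complex_alg = UNIV" "scal complex_alg = (*)" "adj complex_alg = cnj" "unt complex_alg = 1"
  by (simp_all add: linf_def complex_alg_def)

lemma linf_elems_iff:
  "f \<in> elems (linf X) \<longleftrightarrow> (\<exists>B. \<forall>x. norm (f x) \<le> B) \<and> (\<forall>x. x \<notin> X \<longrightarrow> f x = 0)"
proof
  assume "f \<in> elems (linf X)"
  then obtain B where "\<forall>x\<in>X. norm (f x) \<le> B" "\<forall>x. x \<notin> X \<longrightarrow> f x = 0"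
    by (auto simp: linf_def bounded_iff)
  \<comment> \<open>If \<open>X\<close> is empty, \<open>B\<close> may be negative, but
    \<open>f x = 0\<close> still has to obey the bound.\<close>
  then have "norm (f x) \<le> max 0 B" for x by (cases "x \<in> X") auto
  then show "(\<exists>B. \<forall>x. norm (f x) \<le> B) \<and> (\<forall>x. x \<notin> X \<longrightarrow> f x = 0)"
    using \<open>\<forall>x. x \<notin> X \<longrightarrow> f x = 0\<close> by blast
qed (auto simp: linf_def bounded_iff)

lemma linf_elems_add: "f \<in> elems (linf X) \<Longrightarrow> g \<in> elems (linf X) \<Longrightarrow> (\<lambda>x. f x + g x) \<in> elems (linf X)"
  unfolding linf_elems_iff by auto (meson norm_triangle_mono)

lemma linf_elems_mult: "f \<in> elems (linf X) \<Longrightarrow> g \<in> elems (linf X) \<Longrightarrow> (\<lambda>x. f x * g x) \<in> elems (linf X)"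
  unfolding linf_elems_iff by (auto simp: norm_mult) (meson mult_mono' norm_ge_zero)

lemma linf_elems_scal: "f \<in> elems (linf X) \<Longrightarrow> (\<lambda>x. c * f x) \<in> elems (linf X)"
  unfolding linf_elems_iff
  by (auto simp: norm_mult) (meson mult_left_mono norm_ge_zero)

lemma linf_elems_cnj: "f \<in> elems (linf X) \<Longrightarrow> (\<lambda>x. cnj (f x)) \<in> elems (linf X)"
  unfolding linf_elems_iff by auto

lemma linf_elems_zero: "(\<lambda>x. 0) \<in> elems (linf X)"
  unfolding linf_elems_iff by auto

lemma linf_elems_sum:
  "(\<And>i. i \<in> I \<Longrightarrow> f i \<in> elems (linf X)) \<Longrightarrow> (\<lambda>x. \<Sum>i\<in>I. f i x) \<in> elems (linf X)"
  by (induction I rule: infinite_finite_induct) (simp_all add: linf_elems_add linf_elems_zero)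

lemma linf_elems_indicator: "A \<subseteq> X \<Longrightarrow> indicator A \<in> elems (linf X)"
  unfolding linf_elems_iff by (auto simp: indicator_def intro!: exI[of _ 1])

section \<open>Linear functionals and complete positivity\<close>

context
  fixes X :: "'a set" and \<phi> :: "('a \<Rightarrow> complex) \<Rightarrow> complex"
  assumes lin: "alg_linear (linf X) complex_alg \<phi>"
begin

lemma linear_functional_add:
  "f \<in> elems (linf X) \<Longrightarrow> g \<in> elems (linf X) \<Longrightarrow> \<phi> (\<lambda>x. f x + g x) = \<phi> f + \<phi> g"
  using lin by (simp add: alg_linear_def plus_fun_def)

lemma linear_functional_scal: "f \<in> elems (linf X) \<Longrightarrow> \<phi> (\<lambda>x. c * f x) = c * \<phi> f"
  using lin by (simp add: alg_linear_def)

lemma linear_functional_zero: "\<phi> (\<lambda>x. 0) = 0"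
  using linear_functional_scal[OF linf_elems_zero, of 0] by simp

lemma linear_functional_sum:
  "(\<And>i. i \<in> I \<Longrightarrow> f i \<in> elems (linf X)) \<Longrightarrow> \<phi> (\<lambda>x. \<Sum>i\<in>I. f i x) = (\<Sum>i\<in>I. \<phi> (f i))"
  by (induction I rule: infinite_finite_induct)
    (simp_all add: linear_functional_add linear_functional_zero linf_elems_sum)

lemma linear_functional_diff:
  assumes "f \<in> elems (linf X)" "g \<in> elems (linf X)"
  shows "\<phi> (\<lambda>x. f x - g x) = \<phi> f - \<phi> g"
  using linear_functional_add[OF assms(1) linf_elems_scal[OF assms(2), of "-1"]]
    linear_functional_scal[OF assms(2), of "-1"] by simp

text \<open>If \<open>M\<close> has the factor \<open>N\<close>, the form of the matrix
  \<open>\<phi> (M i j)\<close> at \<open>c\<close> is the sum over \<open>k\<close> of the values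
  of \<open>\<phi>\<close> at the squared moduli of \<open>b k\<close>, where \<open>b k\<close> is
  the combination of row \<open>k\<close> of \<open>N\<close> with coefficients \<open>c\<close>.
  Positivity thus makes the form nonnegative, and a Gram factorisation finishes. The converse is the
  case of 1 by 1 matrices. Only linearity of \<open>\<phi>\<close> is assumed because the order on
  morphisms is about differences of functionals.\<close>

lemma completely_positive_iff_positive:
  "completely_positive (linf X) complex_alg \<phi> \<longleftrightarrow>
     (\<forall>b\<in>elems (linf X). \<phi> (\<lambda>x. cnj (b x) * b x) \<in> \<real>\<^sub>\<ge>\<^sub>0)"
proof
  assume cp: "completely_positive (linf X) complex_alg \<phi>"
  show "\<forall>b\<in>elems (linf X). \<phi> (\<lambda>x. cnj (b x) * b x) \<in> \<real>\<^sub>\<ge>\<^sub>0"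
  proof
    fix b assume b: "b \<in> elems (linf X)"
    define M :: "nat \<Rightarrow> nat \<Rightarrow> 'a \<Rightarrow> complex" where "M i j = (\<lambda>x. cnj (b x) * b x)" for i j
    have "mat_positive (linf X) 1 M"
      unfolding mat_positive_def using b
      by (intro exI[of _ "\<lambda>i j. b"]) (auto simp: M_def times_fun_def)
    moreover have "M i j \<in> elems (linf X)" for i j
      unfolding M_def by (intro linf_elems_mult linf_elems_cnj b)
    ultimately have "mat_positive complex_alg 1 (\<lambda>i j. \<phi> (M i j))"
      using cp by (simp add: completely_positive_def)
    then obtain z where "\<phi> (M 0 0) = cnj z * z" by (auto simp: mat_positive_def)
    then show "\<phi> (\<lambda>x. cnj (b x) * b x) \<in> \<real>\<^sub>\<ge>\<^sub>0"
      by (simp add: M_def complex_nonneg_Reals_iff)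
  qed
next
  assume pos: "\<forall>b\<in>elems (linf X). \<phi> (\<lambda>x. cnj (b x) * b x) \<in> \<real>\<^sub>\<ge>\<^sub>0"
  show "completely_positive (linf X) complex_alg \<phi>"
    unfolding completely_positive_def
  proof (intro allI impI; elim conjE)
    fix n M assume "mat_positive (linf X) n M"
    then obtain N where Nel: "\<And>i j. i < n \<Longrightarrow> j < n \<Longrightarrow> N i j \<in> elems (linf X)"
      and M: "\<And>i j. i < n \<Longrightarrow> j < n \<Longrightarrow> M i j = (\<lambda>x. \<Sum>k<n. cnj (N k i x) * N k j x)"
      unfolding mat_positive_def by (auto simp: fun_eq_iff sum_fun_apply) metis
    have "quad_form n (\<lambda>i j. \<phi> (M i j)) c \<in> \<real>\<^sub>\<ge>\<^sub>0" for c
    proof -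
      define b where "b k = (\<lambda>x. \<Sum>j<n. c j * N k j x)" for k
      define e where "e k i j = (\<lambda>x. cnj (N k i x) * N k j x)" for k i j
      have b: "b k \<in> elems (linf X)" if "k < n" for k
        unfolding b_def using that by (intro linf_elems_sum linf_elems_scal Nel) auto
      have e: "e k i j \<in> elems (linf X)" if "k < n" "i < n" "j < n" for k i j
        unfolding e_def using that by (intro linf_elems_mult linf_elems_cnj Nel)
      have bb: "\<phi> (\<lambda>x. cnj (b k x) * b k x) = (\<Sum>i<n. \<Sum>j<n. cnj (c i) * c j * \<phi> (e k i j))"
        if k: "k < n" for k
      proof -
        have eq: "(\<lambda>x. cnj (b k x) * b k x) = (\<lambda>x. \<Sum>i<n. \<Sum>j<n. cnj (c i) * c j * e k i j x)"
          by (simp add: b_def e_def sum_product mult.assoc mult.left_commute)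
        have "\<phi> (\<lambda>x. cnj (b k x) * b k x) = (\<Sum>i<n. \<phi> (\<lambda>x. \<Sum>j<n. cnj (c i) * c j * e k i j x))"
          unfolding eq using k by (intro linear_functional_sum linf_elems_sum linf_elems_scal e) auto
        also have "\<dots> = (\<Sum>i<n. \<Sum>j<n. \<phi> (\<lambda>x. cnj (c i) * c j * e k i j x))"
          using k by (intro sum.cong refl linear_functional_sum linf_elems_scal e) auto
        also have "\<dots> = (\<Sum>i<n. \<Sum>j<n. cnj (c i) * c j * \<phi> (e k i j))"
          using k by (intro sum.cong refl linear_functional_scal e) auto
        finally show ?thesis .
      qed
      have "quad_form n (\<lambda>i j. \<phi> (M i j)) c = (\<Sum>i<n. \<Sum>j<n. cnj (c i) * (\<Sum>k<n. \<phi> (e k i j)) * c j)"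
        unfolding quad_form_def
      proof (intro sum.cong refl)
        fix i j assume ij: "i \<in> {..<n}" "j \<in> {..<n}"
        have "\<phi> (M i j) = \<phi> (\<lambda>x. \<Sum>k<n. e k i j x)" using ij by (simp add: M e_def)
        also have "\<dots> = (\<Sum>k<n. \<phi> (e k i j))" using ij by (intro linear_functional_sum e) auto
        finally show "cnj (c i) * \<phi> (M i j) * c j = cnj (c i) * (\<Sum>k<n. \<phi> (e k i j)) * c j" by simp
      qed
      also have "\<dots> = (\<Sum>i<n. \<Sum>j<n. \<Sum>k<n. cnj (c i) * c j * \<phi> (e k i j))"
        by (simp add: sum_distrib_left sum_distrib_right mult.assoc mult.commute mult.left_commute)
      also have "\<dots> = (\<Sum>i<n. \<Sum>k<n. \<Sum>j<n. cnj (c i) * c j * \<phi> (e k i j))"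
        by (intro sum.cong refl sum.swap)
      also have "\<dots> = (\<Sum>k<n. \<Sum>i<n. \<Sum>j<n. cnj (c i) * c j * \<phi> (e k i j))"
        by (rule sum.swap)
      also have "\<dots> = (\<Sum>k<n. \<phi> (\<lambda>x. cnj (b k x) * b k x))"
        by (intro sum.cong refl bb[symmetric]) auto
      also have "\<dots> \<in> \<real>\<^sub>\<ge>\<^sub>0"
      proof -
        have "\<phi> (\<lambda>x. cnj (b k x) * b k x) \<in> \<real>\<^sub>\<ge>\<^sub>0" if "k < n" for k
          using pos b[OF that] by blast
        then show ?thesis by (auto simp: complex_nonneg_Reals_iff intro!: sum_nonneg sum.neutral)
      qed
      finally show ?thesis .
    qed
    from gram_if_quad_form_nonneg[OF this]
    show "mat_positive complex_alg n (\<lambda>i j. \<phi> (M i j))"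
      by (simp add: mat_positive_def)
  qed
qed

end

section \<open>Expectation with respect to a weight\<close>

lemma summable_on_subprobs_scaleR:
  fixes f :: "'a \<Rightarrow> 'b::banach"
  assumes p: "p \<in> subprobs X" and f: "bounded (range f)"
  shows "(\<lambda>x. p x *\<^sub>R f x) summable_on A"
proof -
  obtain B where B: "\<And>x. norm (f x) \<le> B" using f by (auto simp: bounded_iff)
  have "(\<lambda>x. B * p x) summable_on A"
    using summable_on_subprobs[OF p] by (rule summable_on_cmult_right)
  then have "(\<lambda>x. norm (B * p x)) summable_on A"
    by (rule summable_on_iff_abs_summable_on_real[THEN iffD1])
  then have "(\<lambda>x. norm (p x *\<^sub>R f x)) summable_on A"
  proof (rule Infinite_Sum.abs_summable_on_comparison_test)
    fix x
    have "norm (p x *\<^sub>R f x) = norm (f x) * p x" using subprobsD(1)[OF p] by simp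
    also have "\<dots> \<le> B * p x" using B subprobsD(1)[OF p] by (intro mult_right_mono)
    finally show "norm (p x *\<^sub>R f x) \<le> norm (B * p x)" by simp
  qed
  then show ?thesis by (rule Infinite_Sum.abs_summable_summable)
qed

text \<open>Integration against the weight. Summing over the whole type is harmless as weights
  vanish off \<open>X\<close>; the value type is left open because both complex functions and their
  real counterparts are integrated.\<close>

definition expect :: "('a \<Rightarrow> real) \<Rightarrow> ('a \<Rightarrow> 'b::real_normed_vector) \<Rightarrow> 'b" where
  "expect p f = (\<Sum>\<^sub>\<infinity>x. p x *\<^sub>R f x)"

lemma expect_add:
  fixes f g :: "'a \<Rightarrow> 'b::banach"
  assumes "p \<in> subprobs X" "bounded (range f)" "bounded (range g)"
  shows "expect p (\<lambda>x. f x + g x) = expect p f + expect p g"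
  unfolding expect_def scaleR_add_right
  by (intro infsum_add summable_on_subprobs_scaleR[OF assms(1)] assms)

lemma expect_diff:
  fixes f g :: "'a \<Rightarrow> 'b::banach"
  assumes "p \<in> subprobs X" "bounded (range f)" "bounded (range g)"
  shows "expect p (\<lambda>x. f x - g x) = expect p f - expect p g"
  using expect_add[OF assms(1) bounded_minus_comp[OF assms(2,3)] assms(3)] by simp

lemma expect_mult: "expect p (\<lambda>x. c * f x) = c * expect p f" for c :: complex
  by (simp add: expect_def mult_scaleR_right[symmetric] infsum_cmult_right' del: mult_scaleR_right)

lemma expect_of_real:
  fixes g :: "'a \<Rightarrow> real"
  assumes "p \<in> subprobs X" "bounded (range g)"
  shows "expect p (\<lambda>x. complex_of_real (g x)) = of_real (expect p g)"
proof -
  have "((\<lambda>x. p x *\<^sub>R g x) has_sum expect p g) UNIV"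
    unfolding expect_def by (intro has_sum_infsum summable_on_subprobs_scaleR[OF assms])
  then have "((\<lambda>x. complex_of_real (p x *\<^sub>R g x)) has_sum of_real (expect p g)) UNIV"
    by (rule has_sum_of_real)
  then show ?thesis
    unfolding expect_def[of p "\<lambda>x. complex_of_real (g x)"]
    by (intro infsumI) (simp add: scaleR_conv_of_real)
qed

lemma expect_mono:
  fixes f g :: "'a \<Rightarrow> real"
  assumes "p \<in> subprobs X" "bounded (range f)" "bounded (range g)" "f \<le> g"
  shows "expect p f \<le> expect p g"
  unfolding expect_def
  by (intro infsum_mono summable_on_subprobs_scaleR[OF assms(1)] assms scaleR_left_mono)
    (use assms subprobsD(1) in \<open>auto simp: le_fun_def\<close>)

lemma expect_indicator_singleton:
  "expect p (indicator {x}) = (of_real (p x) :: 'b::real_normed_algebra_1)"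
proof -
  have "expect p (indicator {x}) = (\<Sum>\<^sub>\<infinity>y\<in>{x}. p y *\<^sub>R (indicator {x} y :: 'b))"
    unfolding expect_def by (rule infsum_cong_neutral) auto
  then show ?thesis by (simp add: of_real_def)
qed

lemma expect_point: "expect (\<lambda>y. if y = x then 1 else 0) f = f x"
proof -
  have "expect (\<lambda>y. if y = x then 1 else 0) f = (\<Sum>\<^sub>\<infinity>y\<in>{x}. (if y = x then 1 else 0) *\<^sub>R f y)"
    unfolding expect_def by (rule infsum_cong_neutral) auto
  then show ?thesis by simp
qed

section \<open>Self-adjoint elements as bounded real functions\<close>

definition bounded_supported :: "'a set \<Rightarrow> ('a \<Rightarrow> real) set" where
  "bounded_supported X = {g. bounded (range g) \<and> (\<forall>x. x \<notin> X \<longrightarrow> g x = 0)}"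

text \<open>Bounded functions are not closed under all directed pointwise suprema. Those in question
  lie between a member of the family and a given upper bound, and order convexity then gives
  membership.\<close>

lemma bounded_supported_between:
  assumes "f \<in> bounded_supported X" "h \<in> bounded_supported X" "f \<le> g" "g \<le> h"
  shows "g \<in> bounded_supported X"
proof -
  obtain A B where AB: "\<And>x. \<bar>f x\<bar> \<le> A" "\<And>x. \<bar>h x\<bar> \<le> B"
    using assms(1,2) by (auto simp: bounded_supported_def bounded_iff)
  have "\<bar>g x\<bar> \<le> A + B" for x
    using AB(1)[of x] AB(2)[of x] le_funD[OF assms(3), of x] le_funD[OF assms(4), of x] by linarith
  moreover have "g x = 0" if "x \<notin> X" for x
    using assms(1,2) le_funD[OF assms(3), of x] le_funD[OF assms(4), of x] that
    by (simp add: bounded_supported_def)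
  ultimately show ?thesis by (auto simp: bounded_supported_def bounded_iff)
qed

lemma of_real_in_linf: "g \<in> bounded_supported X \<Longrightarrow> (\<lambda>x. complex_of_real (g x)) \<in> elems (linf X)"
  by (auto simp: bounded_supported_def linf_elems_iff bounded_iff)

lemma Re_Im_bounded_supported:
  assumes "f \<in> elems (linf X)"
  shows "(\<lambda>x. Re (f x)) \<in> bounded_supported X" "(\<lambda>x. Im (f x)) \<in> bounded_supported X"
proof -
  obtain B where B: "\<And>x. cmod (f x) \<le> B" using assms by (auto simp: linf_elems_iff)
  have "\<bar>Re (f x)\<bar> \<le> B" "\<bar>Im (f x)\<bar> \<le> B" for x
    using B[of x] abs_Re_le_cmod[of "f x"] abs_Im_le_cmod[of "f x"] by linarith+
  then show "(\<lambda>x. Re (f x)) \<in> bounded_supported X" "(\<lambda>x. Im (f x)) \<in> bounded_supported X"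
    using assms by (auto simp: bounded_supported_def bounded_iff linf_elems_iff)
qed

lemma alg_positive_complex_iff: "alg_positive complex_alg z \<longleftrightarrow> z \<in> \<real>\<^sub>\<ge>\<^sub>0"
proof
  assume "z \<in> \<real>\<^sub>\<ge>\<^sub>0"
  then obtain r where "z = of_real r" "r \<ge> 0" by (rule nonneg_Reals_cases)
  then have "z = cnj (of_real (sqrt r)) * of_real (sqrt r)" by (simp flip: of_real_mult)
  then show "alg_positive complex_alg z"
    unfolding alg_positive_def star_alg_simps by (intro bexI[of _ "of_real (sqrt r)"]) auto
qed (auto simp: alg_positive_def complex_nonneg_Reals_iff)

lemma alg_positive_linf_iff:
  assumes h: "h \<in> bounded_supported X"
  shows "alg_positive (linf X) (\<lambda>x. complex_of_real (h x)) \<longleftrightarrow> (\<forall>x. 0 \<le> h x)"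
proof
  assume "alg_positive (linf X) (\<lambda>x. complex_of_real (h x))"
  then obtain b where "\<And>x. complex_of_real (h x) = cnj (b x) * b x"
    by (auto simp: alg_positive_def fun_eq_iff)
  then have "Re (complex_of_real (h x)) \<ge> 0" for x by simp
  then show "\<forall>x. 0 \<le> h x" by simp
next
  assume pos: "\<forall>x. 0 \<le> h x"
  obtain B where B: "\<And>x. \<bar>h x\<bar> \<le> B" using h by (auto simp: bounded_supported_def bounded_iff)
  have "norm (complex_of_real (sqrt (h x))) \<le> sqrt B" for x
    using B[of x] pos by simp
  then have "(\<lambda>x. complex_of_real (sqrt (h x))) \<in> elems (linf X)"
    using h by (auto simp: linf_elems_iff bounded_supported_def)
  moreover have "complex_of_real (h x) = cnj (of_real (sqrt (h x))) * of_real (sqrt (h x))" for x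
    using pos by (simp flip: of_real_mult)
  ultimately show "alg_positive (linf X) (\<lambda>x. complex_of_real (h x))"
    unfolding alg_positive_def by (intro bexI) (auto simp: fun_eq_iff)
qed

lemma order_iso_on_self_adjoint_complex:
  "order_iso_on UNIV (\<le>) (self_adjoint complex_alg) (alg_le complex_alg) complex_of_real"
proof -
  have "self_adjoint complex_alg = range complex_of_real"
    by (auto simp: self_adjoint_def complex_eq_iff intro!: image_eqI[of _ _ "Re _"])
  then show ?thesis
    by (auto simp: order_iso_on_def bij_betw_def inj_on_def alg_le_def alg_positive_complex_iff
        complex_nonneg_Reals_iff)
qed

lemma order_iso_on_self_adjoint_linf:
  "order_iso_on (bounded_supported X) (\<le>) (self_adjoint (linf X)) (alg_le (linf X))
     (\<lambda>g x. complex_of_real (g x))"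
  unfolding order_iso_on_def bij_betw_def
proof (intro conjI ballI)
  show "inj_on (\<lambda>g x. complex_of_real (g x)) (bounded_supported X)"
    by (auto simp: inj_on_def fun_eq_iff)
  show "(\<lambda>g x. complex_of_real (g x)) ` bounded_supported X = self_adjoint (linf X)"
  proof (intro equalityI subsetI)
    fix f assume f: "f \<in> self_adjoint (linf X)"
    then have "cnj (f x) = f x" for x by (simp add: self_adjoint_def fun_eq_iff)
    then have "f = (\<lambda>x. complex_of_real (Re (f x)))" by (simp add: fun_eq_iff complex_eq_iff)
    moreover have "(\<lambda>x. Re (f x)) \<in> bounded_supported X"
      using f by (intro Re_Im_bounded_supported) (simp add: self_adjoint_def)
    ultimately show "f \<in> (\<lambda>g x. complex_of_real (g x)) ` bounded_supported X" by (rule image_eqI)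
  qed (auto simp: self_adjoint_def of_real_in_linf)
  fix f g assume "f \<in> bounded_supported X" "g \<in> bounded_supported X"
  then have "(\<lambda>x. g x - f x) \<in> bounded_supported X"
    by (auto simp: bounded_supported_def intro!: bounded_minus_comp)
  from alg_positive_linf_iff[OF this]
  show "f \<le> g \<longleftrightarrow> alg_le (linf X) (\<lambda>x. complex_of_real (f x)) (\<lambda>x. complex_of_real (g x))"
    by (simp add: alg_le_def le_fun_def fun_diff_def)
qed

text \<open>Monotone convergence for directed families of any size. It suffices to bound finite
  partial sums of \<open>s\<close>, and there one member \<open>a\<close> of \<open>S\<close> is
  close to \<open>s\<close> at all points involved. Functions in \<open>S\<close> may be negative,
  so a fixed \<open>a0\<close> below \<open>a\<close> is subtracted: the terms with
  \<open>a - a0\<close> are nonnegative, and their finite sums stay below the full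
  expectation.\<close>

lemma scott_continuous_on_expect:
  assumes p: "p \<in> subprobs X"
  shows "scott_continuous_on (bounded_supported X) (\<le>) UNIV (\<le>) (expect p)"
  unfolding scott_continuous_on_def
proof (intro conjI allI impI; (elim conjE)?)
  fix S s
  assume S: "directed_in (bounded_supported X) (\<le>) S" and s: "is_lub_in (bounded_supported X) (\<le>) S s"
  have bdd: "bounded (range a)" if "a \<in> bounded_supported X" for a
    using that by (simp add: bounded_supported_def)
  have Sb: "a \<in> bounded_supported X" "a \<le> s" if "a \<in> S" for a
    using that S s by (auto simp: directed_in_def is_lub_in_def)
  have sb: "s \<in> bounded_supported X" using s by (simp add: is_lub_in_def)
  obtain a0 where a0: "a0 \<in> S" using S by (auto simp: directed_in_def)
  have app: "\<exists>a\<in>S. s x - e < a x" if "e > 0" for x e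
  proof (rule is_lub_in_funD[OF _ s _ that])
    show "S \<noteq> {}" using a0 by auto
    fix t assume "\<And>a. a \<in> S \<Longrightarrow> a \<le> t" "t \<le> s"
    then show "t \<in> bounded_supported X"
      using bounded_supported_between[OF Sb(1)[OF a0] sb] a0 by blast
  qed
  have "expect p s \<le> u" if u: "\<forall>r\<in>expect p ` S. r \<le> u" for u
  proof -
    have "expect p (\<lambda>x. s x - a0 x) \<le> u - expect p a0"
      unfolding expect_def[of p "\<lambda>x. s x - a0 x"]
    proof (rule infsum_le_finite_sums)
      show "(\<lambda>x. p x *\<^sub>R (s x - a0 x)) summable_on UNIV"
        using bdd[OF sb] bdd[OF Sb(1)[OF a0]]
        by (intro summable_on_subprobs_scaleR[OF p] bounded_minus_comp)
      fix F :: "'a set" assume F: "finite F"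
      show "(\<Sum>x\<in>F. p x *\<^sub>R (s x - a0 x)) \<le> u - expect p a0"
      proof (rule field_le_epsilon)
        fix e :: real assume e: "e > 0"
        obtain a where a: "a \<in> S" "a0 \<le> a" "\<forall>x\<in>F. s x - e < a x"
          using directed_finite_approx[OF S, of F "\<lambda>x. s x - e" a0] app[OF e] F a0 by blast
        have "(\<Sum>x\<in>F. p x *\<^sub>R (s x - a0 x)) \<le> (\<Sum>x\<in>F. p x *\<^sub>R (a x - a0 x) + p x * e)"
        proof (rule sum_mono)
          fix x assume "x \<in> F"
          then have "p x * (s x - a0 x) \<le> p x * (a x - a0 x + e)"
            using a subprobsD(1)[OF p] by (intro mult_left_mono) force+
          then show "p x *\<^sub>R (s x - a0 x) \<le> p x *\<^sub>R (a x - a0 x) + p x * e"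
            by (simp add: distrib_left)
        qed
        also have "\<dots> = (\<Sum>x\<in>F. p x *\<^sub>R (a x - a0 x)) + sum p F * e"
          by (simp add: sum.distrib sum_distrib_right)
        also have "(\<Sum>x\<in>F. p x *\<^sub>R (a x - a0 x)) \<le> expect p (\<lambda>x. a x - a0 x)"
          unfolding expect_def
        proof (rule finite_sum_le_infsum)
          show "(\<lambda>x. p x *\<^sub>R (a x - a0 x)) summable_on UNIV"
            using bdd[OF Sb(1)[OF a(1)]] bdd[OF Sb(1)[OF a0]]
            by (intro summable_on_subprobs_scaleR[OF p] bounded_minus_comp)
          show "0 \<le> p x *\<^sub>R (a x - a0 x)" for x
            using subprobsD(1)[OF p] le_funD[OF a(2), of x] by simp
        qed (use F in auto)
        also have "expect p (\<lambda>x. a x - a0 x) = expect p a - expect p a0"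
          by (intro expect_diff[OF p] bdd Sb a a0)
        also have "expect p a \<le> u" using u a(1) by blast
        \<comment> \<open>The total mass at most 1 absorbs the uniform error, so the tolerance does
          not depend on the size of \<open>F\<close>.\<close>
        also have "sum p F * e \<le> e"
          using subprobsD(3)[OF p F] subprobsD(1)[OF p] e
          by (intro mult_left_le_one_le) (auto intro: sum_nonneg)
        finally show "(\<Sum>x\<in>F. p x *\<^sub>R (s x - a0 x)) \<le> u - expect p a0 + e" by simp
      qed
    qed
    moreover have "expect p (\<lambda>x. s x - a0 x) = expect p s - expect p a0"
      by (intro expect_diff[OF p] bdd Sb sb a0)
    ultimately show ?thesis by simp
  qed
  moreover have "expect p a \<le> expect p s" if "a \<in> S" for a
    using Sb[OF that] sb by (intro expect_mono[OF p] bdd)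
  ultimately show "is_lub_in UNIV (\<le>) (expect p ` S) (expect p s)"
    unfolding is_lub_in_def by blast
qed simp

section \<open>Weights as normal functionals\<close>

definition linf_functional :: "'a set \<Rightarrow> ('a \<Rightarrow> real) \<Rightarrow> ('a \<Rightarrow> complex) \<Rightarrow> complex" where
  "linf_functional X p f = (if f \<in> elems (linf X) then expect p f else 0)"

lemma bounded_range_linf: "f \<in> elems (linf X) \<Longrightarrow> bounded (range f)"
  by (auto simp: linf_elems_iff bounded_iff)

lemma alg_linear_linf_functional:
  assumes p: "p \<in> subprobs X"
  shows "alg_linear (linf X) complex_alg (linf_functional X p)"
  unfolding alg_linear_def
proof (intro conjI ballI allI impI)
  fix f g assume "f \<in> elems (linf X)" "g \<in> elems (linf X)"
  then show "linf_functional X p (f + g) = linf_functional X p f + linf_functional X p g"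
    using expect_add[OF p, of f g] linf_elems_add[of f X g]
    by (simp add: linf_functional_def plus_fun_def bounded_range_linf)
next
  fix c f assume "f \<in> elems (linf X)"
  then show "linf_functional X p (scal (linf X) c f) = scal complex_alg c (linf_functional X p f)"
    by (simp add: linf_functional_def expect_mult linf_elems_scal)
qed (simp_all add: linf_functional_def)

lemma linf_functional_of_real:
  assumes "p \<in> subprobs X" "g \<in> bounded_supported X"
  shows "linf_functional X p (\<lambda>x. complex_of_real (g x)) = of_real (expect p g)"
  using assms of_real_in_linf[OF assms(2)]
  by (simp add: linf_functional_def expect_of_real bounded_supported_def)

lemma linf_functional_indicator_singleton:
  "x \<in> X \<Longrightarrow> linf_functional X p (indicator {x}) = of_real (p x)"
  by (simp add: linf_functional_def expect_indicator_singleton linf_elems_indicator)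

text \<open>Used twice: with the zero weight as \<open>p\<close> it is positivity of a single
  functional, and in general it is monotonicity of the passage from weights to functionals.\<close>

lemma linf_functional_square_diff:
  assumes p: "p \<in> subprobs X" and q: "q \<in> subprobs X" and "p \<le> q" and b: "b \<in> elems (linf X)"
  shows "linf_functional X q (\<lambda>x. cnj (b x) * b x) - linf_functional X p (\<lambda>x. cnj (b x) * b x) \<in> \<real>\<^sub>\<ge>\<^sub>0"
proof -
  define g where "g x = Re (cnj (b x) * b x)" for x
  have g: "g \<in> bounded_supported X"
    unfolding g_def by (intro Re_Im_bounded_supported linf_elems_mult linf_elems_cnj b)
  have eq: "(\<lambda>x. cnj (b x) * b x) = (\<lambda>x. complex_of_real (g x))"
    by (simp add: g_def fun_eq_iff complex_eq_iff)
  have "expect p g \<le> expect q g"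
    unfolding expect_def using g
    by (intro infsum_mono summable_on_subprobs_scaleR[OF p] summable_on_subprobs_scaleR[OF q]
        scaleR_right_mono le_funD[OF \<open>p \<le> q\<close>])
      (auto simp: bounded_supported_def g_def)
  then show ?thesis
    unfolding eq linf_functional_of_real[OF p g] linf_functional_of_real[OF q g]
    by (simp add: complex_nonneg_Reals_iff)
qed

lemma normal_map_linf_functional:
  assumes p: "p \<in> subprobs X"
  shows "normal_map (linf X) complex_alg (linf_functional X p)"
  unfolding normal_map_def
  by (rule scott_continuous_on_transfer[OF order_iso_on_self_adjoint_linf
        order_iso_on_self_adjoint_complex scott_continuous_on_expect[OF p]])
    (rule linf_functional_of_real[OF p])

lemma linf_functional_zero: "linf_functional X (\<lambda>x. 0) = (\<lambda>f. 0)"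
  by (simp add: linf_functional_def expect_def fun_eq_iff)

lemma linf_functional_in_Q_hom:
  assumes p: "p \<in> subprobs X"
  shows "linf_functional X p \<in> Q_hom complex_alg (linf X)"
proof -
  note lin = alg_linear_linf_functional[OF p]
  have "\<forall>b\<in>elems (linf X). linf_functional X p (\<lambda>x. cnj (b x) * b x) \<in> \<real>\<^sub>\<ge>\<^sub>0"
    using linf_functional_square_diff[OF zero_in_subprobs p] subprobsD(1)[OF p]
    by (simp add: linf_functional_zero le_fun_def)
  then have "completely_positive (linf X) complex_alg (linf_functional X p)"
    using completely_positive_iff_positive[OF lin] by blast
  moreover have "subunital (linf X) complex_alg (linf_functional X p)"
  proof -
    have g: "indicator X \<in> bounded_supported X"
      by (auto simp: bounded_supported_def bounded_iff indicator_def intro!: exI[of _ 1])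
    have "expect p (indicator X :: 'a \<Rightarrow> real) = infsum p UNIV"
      unfolding expect_def using subprobsD(2)[OF p] by (intro infsum_cong) (auto simp: indicator_def)
    also have "\<dots> \<le> 1"
      using subprobsD(3)[OF p] by (intro infsum_le_finite_sums summable_on_subprobs[OF p]) auto
    finally have "expect p (indicator X :: 'a \<Rightarrow> real) \<le> 1" .
    moreover have "(\<lambda>x. complex_of_real (indicator X x)) = indicator X"
      by (auto simp: indicator_def)
    ultimately show ?thesis
      using linf_functional_of_real[OF p g]
      by (simp add: subunital_def alg_le_def alg_positive_complex_iff complex_nonneg_Reals_iff)
  qed
  ultimately show ?thesis
    using lin normal_map_linf_functional[OF p] by (simp add: Q_hom_def)
qed

section \<open>Representation of normal functionals by weights\<close>

lemma normal_functional_eqI: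
  assumes lin: "alg_linear (linf X) complex_alg \<phi>" "alg_linear (linf X) complex_alg \<psi>"
    and normal: "normal_map (linf X) complex_alg \<phi>" "normal_map (linf X) complex_alg \<psi>"
    and eq: "\<And>x. x \<in> X \<Longrightarrow> \<phi> (indicator {x}) = \<psi> (indicator {x})"
  shows "\<phi> = \<psi>"
proof -
  let ?h = "\<lambda>(g :: 'a \<Rightarrow> real) x. complex_of_real (g x)"
  have pos: "\<phi> (?h g) = \<psi> (?h g)" if g: "g \<in> bounded_supported X" and g0: "\<And>x. 0 \<le> g x" for g
  proof -
    define b where "b F = (\<lambda>x. if x \<in> F then g x else 0)" for F
    let ?B = "b ` {F. finite F}"
    have zero: "(\<lambda>x. 0) \<in> bounded_supported X" by (simp add: bounded_supported_def)
    have bB: "b F \<in> bounded_supported X" for F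
      by (rule bounded_supported_between[OF zero g]) (use g0 in \<open>auto simp: b_def le_fun_def\<close>)
    have "\<exists>c\<in>?B. a \<le> c \<and> a' \<le> c" if aa: "a \<in> ?B" "a' \<in> ?B" for a a'
    proof -
      obtain F G where FG: "a = b F" "a' = b G" "finite F" "finite G" using aa by auto
      then have "b (F \<union> G) \<in> ?B" by blast
      then show ?thesis
        using g0 FG by (intro bexI[of _ "b (F \<union> G)"]) (auto simp: b_def le_fun_def)
    qed
    then have B: "directed_in (bounded_supported X) (\<le>) ?B"
      unfolding directed_in_def using bB by blast
    have lub: "is_lub_in (bounded_supported X) (\<le>) ?B g"
    proof (rule is_lub_in_funI[OF g])
      show "a \<le> g" if "a \<in> ?B" for a using that g0 by (auto simp: b_def le_fun_def)
      show "\<exists>a\<in>?B. g x - e < a x" if "e > 0" for x e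
      proof
        show "b {x} \<in> ?B" by blast
        show "g x - e < b {x} x" using that by (simp add: b_def)
      qed
    qed
    have BB: "?B \<subseteq> bounded_supported X" using bB by blast
    note o = order_iso_on_self_adjoint_linf
    have fin: "\<omega> (?h (b F)) = (\<Sum>x\<in>F \<inter> X. of_real (g x) * \<omega> (indicator {x}))"
      if \<omega>: "alg_linear (linf X) complex_alg \<omega>" and F: "finite F" for \<omega> F
    proof -
      have eq: "?h (b F) = (\<lambda>y. \<Sum>x\<in>F \<inter> X. of_real (g x) * indicator {x} y)"
      proof
        fix y
        have "(\<Sum>x\<in>F \<inter> X. complex_of_real (g x) * indicator {x} y) =
            (\<Sum>x\<in>F \<inter> X. if x = y then of_real (g x) else 0)"
          by (intro sum.cong) (auto simp: indicator_def)
        also have "\<dots> = of_real (b F y)"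
          using F g by (auto simp: b_def bounded_supported_def)
        finally show "complex_of_real (b F y) = (\<Sum>x\<in>F \<inter> X. of_real (g x) * indicator {x} y)" by simp
      qed
      have "\<omega> (?h (b F)) = (\<Sum>x\<in>F \<inter> X. \<omega> (\<lambda>y. of_real (g x) * indicator {x} y))"
        unfolding eq by (intro linear_functional_sum[OF \<omega>] linf_elems_scal linf_elems_indicator) auto
      also have "\<dots> = (\<Sum>x\<in>F \<inter> X. of_real (g x) * \<omega> (indicator {x}))"
        by (intro sum.cong refl linear_functional_scal[OF \<omega>] linf_elems_indicator) auto
      finally show ?thesis .
    qed
    \<comment> \<open>Both functionals take the same values on the truncations, so by normality
      their values at \<open>g\<close> are least upper bounds of one set. Each is then below the
      other, and antisymmetry of the order on complex numbers gives equality.\<close>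
    have "\<phi> ` ?h ` ?B = \<psi> ` ?h ` ?B"
      unfolding image_image by (intro image_cong refl) (simp add: fin lin eq)
    moreover have "is_lub_in (self_adjoint complex_alg) (alg_le complex_alg) (\<omega> ` ?h ` ?B) (\<omega> (?h g))"
      if "normal_map (linf X) complex_alg \<omega>" for \<omega>
      using that directed_in_image[OF o B] is_lub_in_image[OF o BB lub]
      unfolding normal_map_def scott_continuous_on_def by blast
    ultimately have "alg_le complex_alg (\<phi> (?h g)) (\<psi> (?h g))" "alg_le complex_alg (\<psi> (?h g)) (\<phi> (?h g))"
      using normal unfolding is_lub_in_def by metis+
    then show ?thesis
      by (simp add: alg_le_def alg_positive_complex_iff complex_nonneg_Reals_iff complex_eq_iff)
  qed
  \<comment> \<open>Linearity now extends the equality through positive and negative parts, and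
    afterwards through real and imaginary parts.\<close>
  have real: "\<phi> (?h g) = \<psi> (?h g)" if g: "g \<in> bounded_supported X" for g
  proof -
    have m: "(\<lambda>x. max 0 (g x)) \<in> bounded_supported X" "(\<lambda>x. max 0 (- g x)) \<in> bounded_supported X"
    proof -
      obtain B where B: "\<And>x. \<bar>g x\<bar> \<le> B" using g by (auto simp: bounded_supported_def bounded_iff)
      have "\<bar>max 0 (g x)\<bar> \<le> B" "\<bar>max 0 (- g x)\<bar> \<le> B" for x using B[of x] by auto
      then show "(\<lambda>x. max 0 (g x)) \<in> bounded_supported X" "(\<lambda>x. max 0 (- g x)) \<in> bounded_supported X"
        using g by (auto simp: bounded_supported_def bounded_iff)
    qed
    have g_eq: "?h g = (\<lambda>x. of_real (max 0 (g x)) - of_real (max 0 (- g x)))"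
      by (auto simp: fun_eq_iff max_def simp flip: of_real_diff)
    have dec: "\<omega> (?h g) = \<omega> (\<lambda>x. of_real (max 0 (g x))) - \<omega> (\<lambda>x. of_real (max 0 (- g x)))"
      if "alg_linear (linf X) complex_alg \<omega>" for \<omega>
      unfolding g_eq by (intro linear_functional_diff[OF that] of_real_in_linf m)
    show ?thesis
      unfolding dec[OF lin(1)] dec[OF lin(2)] pos[OF m(1), simplified] pos[OF m(2), simplified] ..
  qed
  show ?thesis
  proof
    fix f
    show "\<phi> f = \<psi> f"
    proof (cases "f \<in> elems (linf X)")
      case True
      note ri = Re_Im_bounded_supported[OF True]
      have f_eq: "f = (\<lambda>x. of_real (Re (f x)) + \<i> * of_real (Im (f x)))"
        by (simp add: fun_eq_iff complex_eq_iff)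
      have dec: "\<omega> f = \<omega> (\<lambda>x. of_real (Re (f x))) + \<i> * \<omega> (\<lambda>x. of_real (Im (f x)))"
        if \<omega>: "alg_linear (linf X) complex_alg \<omega>" for \<omega>
      proof -
        have "\<omega> f = \<omega> (\<lambda>x. of_real (Re (f x)) + \<i> * of_real (Im (f x)))" using f_eq by simp
        also have "\<dots> = \<omega> (\<lambda>x. of_real (Re (f x))) + \<omega> (\<lambda>x. \<i> * of_real (Im (f x)))"
          by (intro linear_functional_add[OF \<omega>] linf_elems_scal of_real_in_linf ri)
        also have "\<omega> (\<lambda>x. \<i> * of_real (Im (f x))) = \<i> * \<omega> (\<lambda>x. of_real (Im (f x)))"
          by (intro linear_functional_scal[OF \<omega>] of_real_in_linf ri)
        finally show ?thesis .
      qed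
      show ?thesis
        unfolding dec[OF lin(1)] dec[OF lin(2)] real[OF ri(1)] real[OF ri(2)] ..
    qed (use lin in \<open>simp add: alg_linear_def\<close>)
  qed
qed

lemma Q_hom_eq_linf_functional:
  assumes \<phi>: "\<phi> \<in> Q_hom complex_alg (linf X)"
  obtains p where "p \<in> subprobs X" "\<phi> = linf_functional X p"
proof
  define p where "p x = (if x \<in> X then Re (\<phi> (indicator {x})) else 0)" for x
  have lin: "alg_linear (linf X) complex_alg \<phi>" and normal: "normal_map (linf X) complex_alg \<phi>"
    and cp: "completely_positive (linf X) complex_alg \<phi>" and sub: "subunital (linf X) complex_alg \<phi>"
    using \<phi> by (auto simp: Q_hom_def)
  have ind: "\<phi> (indicator A) \<in> \<real>\<^sub>\<ge>\<^sub>0" if "A \<subseteq> X" for A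
  proof -
    \<comment> \<open>An indicator is a projection, hence the square of its own modulus, so
      positivity applies to it.\<close>
    have "(\<lambda>x. cnj (indicator A x) * indicator A x :: complex) = indicator A"
      by (auto simp: indicator_def)
    then show ?thesis
      using cp linf_elems_indicator[OF that] unfolding completely_positive_iff_positive[OF lin] by force
  qed
  have p_eq: "\<phi> (indicator {x}) = of_real (p x)" "0 \<le> p x" if "x \<in> X" for x
    using ind[of "{x}"] that by (auto simp: p_def complex_nonneg_Reals_iff complex_eq_iff)
  have "sum p F \<le> 1" if F: "finite F" for F
  proof -
    have "sum p F = sum p (F \<inter> X)"
      by (rule sum.mono_neutral_right) (use F in \<open>auto simp: p_def\<close>)
    have "indicator (F \<inter> X) = (\<lambda>y. \<Sum>x\<in>F \<inter> X. indicator {x} y :: complex)"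
      using F by (auto simp: indicator_def)
    then have "\<phi> (indicator (F \<inter> X)) = (\<Sum>x\<in>F \<inter> X. \<phi> (indicator {x}))"
      using linear_functional_sum[OF lin, of "F \<inter> X" "\<lambda>x. indicator {x}"]
      by (simp add: linf_elems_indicator)
    also have "\<dots> = of_real (sum p F)"
      using \<open>sum p F = sum p (F \<inter> X)\<close> by (simp add: p_eq)
    finally have 1: "\<phi> (indicator (F \<inter> X)) = of_real (sum p F)" .
    \<comment> \<open>The remainder \<open>X - F\<close> has a nonnegative value, so the mass of
      \<open>F\<close> is at most the value at the unit, which subunitality bounds by 1.\<close>
    have "indicator X = (\<lambda>x. indicator (F \<inter> X) x + indicator (X - F) x :: complex)"
      by (auto simp: indicator_def)
    then have "\<phi> (indicator X) = \<phi> (indicator (F \<inter> X)) + \<phi> (indicator (X - F))"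
      using linear_functional_add[OF lin, of "indicator (F \<inter> X)" "indicator (X - F)"]
      by (simp add: linf_elems_indicator)
    moreover have "1 - \<phi> (indicator X) \<in> \<real>\<^sub>\<ge>\<^sub>0"
      using sub by (simp add: subunital_def alg_le_def alg_positive_complex_iff)
    ultimately show ?thesis
      using ind[of "X - F"] by (simp add: 1 complex_nonneg_Reals_iff)
  qed
  then show p: "p \<in> subprobs X"
    using p_eq(2) by (auto simp: subprobs_def p_def)
  show "\<phi> = linf_functional X p"
    by (rule normal_functional_eqI[OF lin alg_linear_linf_functional[OF p] normal
          normal_map_linf_functional[OF p]])
      (simp add: p_eq linf_functional_indicator_singleton)
qed

lemma linf_functional_comb:
  assumes "p \<in> subprobs X" "q \<in> subprobs X"
  shows "linf_functional X (\<lambda>x. r * p x + (1 - r) * q x) f =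
    of_real r * linf_functional X p f + of_real (1 - r) * linf_functional X q f"
proof (cases "f \<in> elems (linf X)")
  case True
  have "(\<lambda>x. (r * p x + (1 - r) * q x) *\<^sub>R f x) =
      (\<lambda>x. r *\<^sub>R (p x *\<^sub>R f x) + (1 - r) *\<^sub>R (q x *\<^sub>R f x))"
    by (simp add: fun_eq_iff scaleR_add_left)
  then show ?thesis
    using True bounded_range_linf[OF True]
    by (simp add: linf_functional_def expect_def infsum_add infsum_scaleR_right summable_on_scaleR_right
        summable_on_subprobs_scaleR[OF assms(1)] summable_on_subprobs_scaleR[OF assms(2)]
        scaleR_conv_of_real[symmetric] del: scaleR_scaleR of_real_diff)
qed (simp add: linf_functional_def)

text \<open>The weights are recovered by evaluating the positive difference at the projections
  \<open>indicator {x}\<close>.\<close>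

lemma linf_functional_le_iff:
  assumes p: "p \<in> subprobs X" and q: "q \<in> subprobs X"
  shows "completely_positive (linf X) complex_alg (\<lambda>f. linf_functional X q f - linf_functional X p f)
    \<longleftrightarrow> p \<le> q"
proof -
  have lin: "alg_linear (linf X) complex_alg (\<lambda>f. linf_functional X q f - linf_functional X p f)"
    using alg_linear_linf_functional[OF p] alg_linear_linf_functional[OF q]
    by (auto simp: alg_linear_def right_diff_distrib)
  show ?thesis
    unfolding completely_positive_iff_positive[OF lin]
  proof
    assume pos: "\<forall>b\<in>elems (linf X). linf_functional X q (\<lambda>x. cnj (b x) * b x) -
      linf_functional X p (\<lambda>x. cnj (b x) * b x) \<in> \<real>\<^sub>\<ge>\<^sub>0"
    show "p \<le> q"
    proof (rule le_funI)
      fix x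
      show "p x \<le> q x"
      proof (cases "x \<in> X")
        case True
        then have "(indicator {x} :: 'a \<Rightarrow> complex) \<in> elems (linf X)" by (simp add: linf_elems_indicator)
        moreover have "(\<lambda>y. cnj (indicator {x} y) * indicator {x} y :: complex) = indicator {x}"
          by (auto simp: indicator_def)
        ultimately have "linf_functional X q (indicator {x}) - linf_functional X p (indicator {x}) \<in> \<real>\<^sub>\<ge>\<^sub>0"
          using pos by metis
        then show ?thesis
          using True by (simp add: linf_functional_indicator_singleton complex_nonneg_Reals_iff)
      qed (simp add: subprobsD(2)[OF p] subprobsD(2)[OF q])
    qed
  qed (use linf_functional_square_diff[OF p q] in blast)
qed

lemma kegelspitze_iso_linf_functional:
  "kegelspitze_iso (subprob_kegel X) (Q_kegel complex_alg (linf X)) (linf_functional X)"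
proof -
  have "inj_on (linf_functional X) (subprobs X)"
  proof (rule inj_onI, rule ext)
    fix p q x assume "p \<in> subprobs X" "q \<in> subprobs X" "linf_functional X p = linf_functional X q"
    then show "p x = q x"
      using linf_functional_indicator_singleton[of x X p] linf_functional_indicator_singleton[of x X q]
      by (cases "x \<in> X") (simp_all add: subprobsD(2))
  qed
  moreover have "linf_functional X ` subprobs X = Q_hom complex_alg (linf X)"
    using linf_functional_in_Q_hom Q_hom_eq_linf_functional by (metis image_eqI image_subsetI subsetI subset_antisym)
  ultimately show ?thesis
    by (auto simp: kegelspitze_iso_def subprob_kegel_def Q_kegel_def bij_betw_def
        linf_functional_le_iff linf_functional_zero linf_functional_comb fun_eq_iff)
qed

section \<open>Unital star-homomorphisms as point evaluations\<close>

lemma point_in_subprobs: "x \<in> X \<Longrightarrow> (\<lambda>y. if y = x then 1 else 0) \<in> subprobs X"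
  by (auto simp: subprobs_def)

text \<open>Multiplicativity and compatibility with adjoints turn the value at a squared modulus
  into the squared modulus of a value, and unital maps are subunital.\<close>

lemma star_homs_subset_Q_hom:
  "normal_unital_star_homs (linf X) complex_alg \<subseteq> Q_hom complex_alg (linf X)"
proof
  fix \<phi> assume \<phi>: "\<phi> \<in> normal_unital_star_homs (linf X) complex_alg"
  then have lin: "alg_linear (linf X) complex_alg \<phi>" by (simp add: normal_unital_star_homs_def)
  have "\<phi> (\<lambda>x. cnj (b x) * b x) \<in> \<real>\<^sub>\<ge>\<^sub>0" if "b \<in> elems (linf X)" for b
  proof -
    have "\<phi> (\<lambda>x. cnj (b x) * b x) = \<phi> (\<lambda>x. cnj (b x)) * \<phi> b"
      using \<phi> linf_elems_cnj[OF that] that by (simp add: normal_unital_star_homs_def times_fun_def)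
    also have "\<phi> (\<lambda>x. cnj (b x)) = cnj (\<phi> b)"
      using \<phi> that by (simp add: normal_unital_star_homs_def)
    finally show ?thesis by (simp add: complex_nonneg_Reals_iff)
  qed
  then have "completely_positive (linf X) complex_alg \<phi>"
    using completely_positive_iff_positive[OF lin] by blast
  then show "\<phi> \<in> Q_hom complex_alg (linf X)"
    using \<phi> by (simp add: Q_hom_def normal_unital_star_homs_def subunital_def alg_le_def
        alg_positive_complex_iff)
qed

lemma normal_unital_star_homs_linf:
  "normal_unital_star_homs (linf X) complex_alg =
     (\<lambda>x. linf_functional X (\<lambda>y. if y = x then 1 else 0)) ` X"
proof (intro equalityI subsetI)
  fix \<phi> assume \<phi>: "\<phi> \<in> normal_unital_star_homs (linf X) complex_alg"
  obtain p where p: "p \<in> subprobs X" and \<phi>p: "\<phi> = linf_functional X p"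
    using Q_hom_eq_linf_functional star_homs_subset_Q_hom \<phi> by blast
  have idem: "p x = 0 \<or> p x = 1" if "x \<in> X" for x
  proof -
    have "(indicator {x} :: 'a \<Rightarrow> complex) \<in> elems (linf X)" using that by (simp add: linf_elems_indicator)
    moreover have "indicator {x} * indicator {x} = (indicator {x} :: 'a \<Rightarrow> complex)"
      by (auto simp: indicator_def fun_eq_iff)
    ultimately have "\<phi> (indicator {x}) = \<phi> (indicator {x}) * \<phi> (indicator {x})"
      using \<phi> unfolding normal_unital_star_homs_def by fastforce
    then have "complex_of_real (p x) = of_real (p x * p x)"
      using that by (simp add: \<phi>p linf_functional_indicator_singleton)
    then have "p x = p x * p x" by (simp only: of_real_eq_iff)
    then show ?thesis by auto
  qed
  \<comment> \<open>Normality is decisive here, through the representation by \<open>p\<close>: a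
    limit along a free ultrafilter is a unital star-homomorphism that vanishes at every
    singleton.\<close>
  have "\<exists>x\<in>X. p x \<noteq> 0"
  proof (rule ccontr)
    assume "\<not> ?thesis"
    then have "p = (\<lambda>x. 0)" using subprobsD(2)[OF p] by blast
    then have "\<phi> (indicator X) = 0" by (simp add: \<phi>p linf_functional_zero)
    moreover have "\<phi> (indicator X) = 1" using \<phi> by (simp add: normal_unital_star_homs_def)
    ultimately show False by simp
  qed
  then obtain x where x: "x \<in> X" "p x = 1" using idem by blast
  have "p y = 0" if "y \<noteq> x" for y
    using subprobsD(3)[OF p, of "{x, y}"] subprobsD(1)[OF p, of y] that x by simp
  then have "p = (\<lambda>y. if y = x then 1 else 0)" using x by auto
  then show "\<phi> \<in> (\<lambda>x. linf_functional X (\<lambda>y. if y = x then 1 else 0)) ` X"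
    using x \<phi>p by blast
next
  fix \<phi> assume "\<phi> \<in> (\<lambda>x. linf_functional X (\<lambda>y. if y = x then 1 else 0)) ` X"
  then obtain x where x: "x \<in> X" and \<phi>: "\<phi> = linf_functional X (\<lambda>y. if y = x then 1 else 0)" by blast
  note p = point_in_subprobs[OF x]
  \<comment> \<open>The functional of a point weight is evaluation at that point, so the algebraic
    conditions become pointwise identities.\<close>
  have ev: "\<phi> f = f x" if "f \<in> elems (linf X)" for f
    using that by (simp add: \<phi> linf_functional_def expect_point)
  have "alg_linear (linf X) complex_alg \<phi>" "normal_map (linf X) complex_alg \<phi>"
    unfolding \<phi> by (intro alg_linear_linf_functional normal_map_linf_functional p)+
  moreover have "\<phi> (f * g) = \<phi> f * \<phi> g" if "f \<in> elems (linf X)" "g \<in> elems (linf X)" for f g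
    using that linf_elems_mult[OF that] by (simp add: ev times_fun_def)
  ultimately show "\<phi> \<in> normal_unital_star_homs (linf X) complex_alg"
    using x by (simp add: normal_unital_star_homs_def ev linf_elems_cnj linf_elems_indicator)
qed

theorem mainTheorem2:
  fixes X :: "'a set"
  shows "continuous_kegelspitze (Q_kegel complex_alg (linf X)) \<and>
    continuous_kegelspitze (valuation_kegel X (=)) \<and>
    (\<exists>r. kegelspitze_iso (Q_kegel complex_alg (linf X)) (valuation_kegel X (=)) r \<and>
         normal_unital_star_homs (linf X) complex_alg \<subseteq> Q_hom complex_alg (linf X) \<and>
         bij_betw r (normal_unital_star_homs (linf X) complex_alg) {dirac X (=) x | x. x \<in> X})"
proof (intro conjI exI)
  let ?\<Phi> = "linf_functional X"
  \<comment> \<open>A functional is sent to the valuation that has the same point masses.\<close>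
  let ?r = "discrete_valuation X \<circ> inv_into (kset (subprob_kegel X)) ?\<Phi>"
  note \<Phi> = kegelspitze_iso_linf_functional[of X]
  show "continuous_kegelspitze (Q_kegel complex_alg (linf X))"
    "continuous_kegelspitze (valuation_kegel X (=))"
    by (rule continuous_kegelspitze_transfer[OF _ continuous_kegelspitze_subprob];
        rule \<Phi> kegelspitze_iso_discrete_valuation)+
  show iso: "kegelspitze_iso (Q_kegel complex_alg (linf X)) (valuation_kegel X (=)) ?r"
    by (rule kegelspitze_iso_inv_comp[OF \<Phi> kegelspitze_iso_discrete_valuation kegelspitze_subprob])
  show sub: "normal_unital_star_homs (linf X) complex_alg \<subseteq> Q_hom complex_alg (linf X)"
    by (rule star_homs_subset_Q_hom)
  have "inj_on ?r (normal_unital_star_homs (linf X) complex_alg)"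
    \<comment> \<open>Injectivity is inherited from the isomorphism on all morphisms; only the image
      remains, and point weights are mapped to Dirac valuations.\<close>
    using iso sub inj_on_subset by (fastforce simp: kegelspitze_iso_def bij_betw_def Q_kegel_def)
  moreover have "?r (?\<Phi> (\<lambda>y. if y = x then 1 else 0)) = dirac X (=) x" if "x \<in> X" for x
  proof -
    have "inj_on ?\<Phi> (kset (subprob_kegel X))"
      using \<Phi> by (simp add: kegelspitze_iso_def bij_betw_def)
    moreover have "(\<lambda>y. if y = x then 1 else 0) \<in> kset (subprob_kegel X)"
      using point_in_subprobs[OF that] by (simp add: subprob_kegel_def)
    ultimately show ?thesis
      by (simp add: dirac_eq_discrete_valuation[OF that])
  qed
  then have "?r ` normal_unital_star_homs (linf X) complex_alg = {dirac X (=) x | x. x \<in> X}"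
    unfolding normal_unital_star_homs_linf image_image by (auto simp: image_iff)
  ultimately show "bij_betw ?r (normal_unital_star_homs (linf X) complex_alg) {dirac X (=) x | x. x \<in> X}"
    by (simp add: bij_betw_def)
qed

end
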